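(* Let $\lambda>0$, $b\in(0,1]$, $T>0$, let $\{X_t\}_{0\le t\le T}\sim\mathrm{Exp}(\lambda,b,T)$ and $\nabla X_t=X_t-X_{t-d}$, where $d>0$. (i) For $0<t<s<T$ and $0<d<s-t$, $d\le t$, $$\mathrm E(\nabla X_t\nabla X_s)=\frac{be^{-\lambda T}}{\lambda^2}\,e^{-\lambda(s-t)}\big(e^{\lambda d}-2+e^{-\lambda d}\big).$$ As $d=\Delta\to0$, with $c'=be^{-\lambda T}$, $$\mathrm E(\nabla X_t\nabla X_s)\sim\Delta^2c'e^{-\lambda(s-t)},\qquad\mathrm{cov}(\nabla X_t,\nabla X_s)\sim\Delta^2c'\big(e^{-\lambda(s-t)}-be^{-\lambda T}\big),\qquad \mathrm{corr}(\nabla X_t,\nabla X_s)\sim\frac{e^{-\lambda(s-t)}-be^{-\lambda T}}{1-be^{-\lambda T}} .$$ (ii) If $0<s-t<d$ (with $d\le t$), then as $s-t\to0$, $$\mathrm{corr}(\nabla X_t,\nabla X_s)\sim1-c'(s-t),\qquad c'=\frac{2be^{-\lambda T}}{\lambda^2\,\mathrm{var}(\nabla X_t)} .$$ (iii) For any $m\in\mathbb N$, $0<t_1<\cdots<t_m\le T$ and $k_1,\dots,k_m\in\mathbb N$, with $c'=be^{-\lambda T}$, as $d=\Delta\to0$, $$\mathrm E\Big(\prod_{i=1}^m(\nabla X_{t_i})^{k_i}\Big)\sim\Delta^{\sum_{i=1}^mk_i}\,c'\,e^{-\lambda(t_m-t_1)},\qquad \lim_{d\to0}\frac{\mathrm E\big(\prod_{i=1}^m(\nabla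 X_{t_i})^{k_i}\big)}{\prod_{i=1}^m\mathrm E\big((\nabla X_{t_i})^{k_i}\big)}=(1/c')^{m-1}e^{-\lambda(t_m-t_1)} .$$
   Context: $u\sim v$ denotes asymptotic equivalence: $u/v\to1$ in the indicated limit. The exponential process $\mathrm{Exp}(\lambda,b,T)$ is the process $X$ on $[0,T]$ with $X_0=0$ and stationary increments whose finite-dimensional laws are determined as follows. Let $a_T=be^{-\lambda T}$. For $0=t_0<t_1<\cdots<t_m\le T$, $s_j\in\mathbb R$, $S_i=\sum_{j=i}^ms_j$, $$\mathrm E\big(e^{s_1X_{t_1}+\cdots+s_mX_{t_m}}\big)=1+a_T\sum_{\emptyset\ne C\subset\{1,\dots,m\}}\sum_{k_1,\dots,k_{|C|}\in\mathbb N}t_{C(|C|)}^{\sum_ik_i}\Big(\prod_{i=1}^{|C|}S_{C(i)}^{k_i}\Big)A(C,\{k_i\}),$$ where $C(i)$ is the $i$-th smallest element of $C$ and, with $q=|C|$, $\tau=t_{C(q)}$, $C_1=\{i\le q:k_i=1\}$, $C_2=\{i\le q:k_i\ge2\}$, $$A(C,\{k_i\})=\int_{Q_C}\prod_{i\in C_2}\frac{(x_i-x_i')^{k_i-2}}{\Gamma(k_i-1)}\;e^{-\lambda\tau(x_q-\bar x_1)}\,dx'\,dx,\qquad \bar x_1=x_1'\text{ if }k_1\ge2,\ \bar x_1=x_1\text{ if }k_1=1,$$ integrating over $Q_C$: $t_{C(i)-1}/\tau<x_i'<x_i<t_{C(i)}/\tau$ for $i\in C_2$, $t_{C(j)-1}/\tau<x_j<t_{C(j)}/\tau$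 for $j\in C_1$ ($t_{C(i)-1}$ is $t_r$ with $r=C(i)-1$). Equivalently, it is the EML$(\alpha,\lambda,b,T)$ process with $\alpha=1$; its marginal mgf is $$\mathrm E(e^{sX_t})=1+tbe^{-\lambda T}s+be^{-\lambda T}s^2\,\frac{t-(\lambda-s)^{-1}(1-e^{-t(\lambda-s)})}{\lambda-s}\qquad(s\neq\lambda).$$ *)

theory Defs
  imports "HOL-Probability.Probability" "HOL-Library.Landau_Symbols"
begin

text \<open>
  The multi-indices \<open>k\<close> and the integration variables \<open>x\<close>, \<open>x'\<close> attached to a nonempty finite set
  \<open>C\<close> of positive indices are indexed by the elements of \<open>C\<close> themselves rather than by their ranks
  \<open>1, \<dots>, |C|\<close> in \<open>C\<close>.  The first and the last rank thus become \<open>Min C\<close> and \<open>Max C\<close>, and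
  the variables \<open>x'\<close> exist only for the indices in \<open>exp_C2 C k\<close>.
\<close>

definition exp_C1 :: "nat set \<Rightarrow> (nat \<Rightarrow> nat) \<Rightarrow> nat set" where
  "exp_C1 C k = {i \<in> C. k i = 1}"

definition exp_C2 :: "nat set \<Rightarrow> (nat \<Rightarrow> nat) \<Rightarrow> nat set" where
  "exp_C2 C k = {i \<in> C. k i \<ge> 2}"

definition exp_Q :: "(nat \<Rightarrow> real) \<Rightarrow> nat set \<Rightarrow> (nat \<Rightarrow> nat) \<Rightarrow> ((nat \<Rightarrow> real) \<times> (nat \<Rightarrow> real)) set" where
  "exp_Q t C k = (let \<tau> = t (Max C) in
     {(x, x').
        (\<forall>i\<in>exp_C2 C k. t (i - 1) / \<tau> < x' i \<and> x' i < x i \<and> x i < t i / \<tau>) \<and>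
        (\<forall>j\<in>exp_C1 C k. t (j - 1) / \<tau> < x j \<and> x j < t j / \<tau>)})"

definition exp_A :: "real \<Rightarrow> (nat \<Rightarrow> real) \<Rightarrow> nat set \<Rightarrow> (nat \<Rightarrow> nat) \<Rightarrow> real" where
  "exp_A lam t C k =
     set_lebesgue_integral
       ((\<Pi>\<^sub>M i\<in>C. lborel) \<Otimes>\<^sub>M (\<Pi>\<^sub>M i\<in>exp_C2 C k. lborel)) (exp_Q t C k)
       (\<lambda>(x, x').
          (\<Prod>i\<in>exp_C2 C k. (x i - x' i) ^ (k i - 2) / Gamma (real (k i) - 1)) *
          exp (- lam * t (Max C) *
               (x (Max C) - (if k (Min C) \<ge> 2 then x' (Min C) else x (Min C)))))"

definition exp_mgf ::
  "real \<Rightarrow> real \<Rightarrow> real \<Rightarrow> nat \<Rightarrow> (nat \<Rightarrow> real) \<Rightarrow> (nat \<Rightarrow> real) \<Rightarrow> real" where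
  "exp_mgf lam b T m t s =
     1 + b * exp (- lam * T) *
       (\<Sum>C | C \<subseteq> {1..m} \<and> C \<noteq> {}.
          \<Sum>\<^sub>\<infinity>k \<in> (\<Pi>\<^sub>E i\<in>C. {1..}).
            t (Max C) ^ (\<Sum>i\<in>C. k i) * (\<Prod>i\<in>C. (\<Sum>j=i..m. s j) ^ k i) * exp_A lam t C k)"

text \<open>
  Only the restriction of \<open>X\<close> to the time interval \<open>[0, T]\<close> is constrained.  Stationarity of the
  increments is equality in law of whole processes, with respect to the product sigma-algebra, i.e.
  equality of all finite-dimensional laws.  The integrability assumption
  is needed because the Bochner integral of a non-integrable function is 0.
\<close>

locale exp_process = prob_space M
  for M :: "'a measure" and lam b T :: real and X :: "real \<Rightarrow> 'a \<Rightarrow> real" +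
  assumes random_variable_X: "\<And>t. t \<in> {0..T} \<Longrightarrow> random_variable borel (X t)"
  assumes X_0: "AE \<omega> in M. X 0 \<omega> = 0"
  assumes stationary_increments:
    "\<And>h. h \<in> {0..T} \<Longrightarrow>
       distr M (\<Pi>\<^sub>M u\<in>{0..T-h}. borel) (\<lambda>\<omega>. \<lambda>u\<in>{0..T-h}. X (u + h) \<omega> - X h \<omega>) =
       distr M (\<Pi>\<^sub>M u\<in>{0..T-h}. borel) (\<lambda>\<omega>. \<lambda>u\<in>{0..T-h}. X u \<omega> - X 0 \<omega>)"
  assumes integrable_exp:
    "\<And>(m::nat) (t::nat \<Rightarrow> real) (s::nat \<Rightarrow> real). t 0 = 0 \<Longrightarrow> strict_mono_on {0..m} t \<Longrightarrow> t m \<le> T \<Longrightarrow>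
       integrable M (\<lambda>\<omega>. exp (\<Sum>j=1..m. s j * X (t j) \<omega>))"
  assumes mgf:
    "\<And>(m::nat) (t::nat \<Rightarrow> real) (s::nat \<Rightarrow> real). t 0 = 0 \<Longrightarrow> strict_mono_on {0..m} t \<Longrightarrow> t m \<le> T \<Longrightarrow>
       expectation (\<lambda>\<omega>. exp (\<Sum>j=1..m. s j * X (t j) \<omega>)) = exp_mgf lam b T m t s"

definition nabla :: "(real \<Rightarrow> 'a \<Rightarrow> real) \<Rightarrow> real \<Rightarrow> real \<Rightarrow> 'a \<Rightarrow> real" where
  "nabla X d t \<omega> = X t \<omega> - X (t - d) \<omega>"

definition cov :: "'a measure \<Rightarrow> ('a \<Rightarrow> real) \<Rightarrow> ('a \<Rightarrow> real) \<Rightarrow> real" where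
  "cov M U V = prob_space.expectation M
     (\<lambda>\<omega>. (U \<omega> - prob_space.expectation M U) * (V \<omega> - prob_space.expectation M V))"

definition corr :: "'a measure \<Rightarrow> ('a \<Rightarrow> real) \<Rightarrow> ('a \<Rightarrow> real) \<Rightarrow> real" where
  "corr M U V = cov M U V / (sqrt (prob_space.variance M U) * sqrt (prob_space.variance M V))"

text \<open>
  The limit \<open>s - t \<rightarrow> 0\<close> over all pairs \<open>(t, s)\<close> with \<open>d \<le> t\<close>, \<open>0 < s - t < d\<close> and \<open>s \<le> T\<close>;
  neither \<open>t\<close> nor \<open>s\<close> is held fixed.
\<close>

definition gap_to_0 :: "real \<Rightarrow> real \<Rightarrow> (real \<times> real) filter" where
  "gap_to_0 d T = inf (filtercomap (\<lambda>(t, s). s - t) (nhds 0))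
                      (principal {(t, s). d \<le> t \<and> 0 < s - t \<and> s - t < d \<and> s \<le> T})"

end

theory Submission
  imports Defs
begin

text \<open>
  Write \<open>a = b * exp (- lam * T)\<close>.  Expressed in the increments over the grid intervals, the moment
  generating function is a power series in several variables that converges everywhere, so comparing
  coefficients turns it into a formula for all joint moments of the increments.  After the powers of
  \<open>t (Max C)\<close> and the factorials are cancelled, such a moment is \<open>a\<close> times the integral of
  \<open>exp (- lam * (largest variable - smallest variable))\<close> over a product of grid intervals (each interval
  occurring \<open>k i\<close> times).  For intervals of length \<open>d\<close> it therefore lies between
  \<open>a * exp (- lam * (t m - t 1 + d)) * d ^ (\<Sum>i. k i)\<close> and
  \<open>a * exp (- lam * (t m - t 1 - d)) * d ^ (\<Sum>i. k i)\<close>, which gives all the limits as \<open>d\<close> tends to \<open>0\<close>.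
  In part (ii) both sides tend to \<open>1\<close>.
\<close>

text \<open>The base variables of the generating function are the tail sums of the
  \<open>s j\<close>. Summation by parts shows that these are dual to the increments
  \<open>X (t i) - X (t (i - 1))\<close>, which is why increments are the natural objects. For
  \<open>k i \<ge> 2\<close> the variables \<open>x' i < x i\<close> stand for the smallest and the
  largest of \<open>k i\<close> points in a grid interval, and the kernel is the volume of the
  ordered positions of the points between them; this is where the factorials come from. Exact
  integration is carried out only where identities are required: for the mean, where the weight is
  constantly 1, and for two separated increments. Everywhere else it is enough to bound the weight.
  Two points need more than such moments. In (ii) the increments overlap and neither
  \<open>t\<close> nor \<open>s\<close> is fixed, so the estimate must be uniform in
  \<open>t\<close>; stationarity supplies this by making the variance of \<open>nabla X d t\<close>
  independent of \<open>t\<close>. The limits of correlations need nonzero variances, which come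
  from \<open>a \<le> exp (- lam * T)\<close>, a consequence of \<open>b \<le> 1\<close>.\<close>

subsection \<open>Moments from a moment generating function\<close>

text \<open>Partial sums of the series of \<open>exp (s * Y)\<close> are dominated by
  \<open>exp (s * Y) + exp (- s * Y)\<close>. Integrability at both \<open>s\<close> and
  \<open>-s\<close> therefore gives dominated convergence, and at \<open>s = 1\<close> it controls
  every power of \<open>Y\<close>.\<close>

lemma
  fixes W Y :: "'a \<Rightarrow> real"
  assumes W[measurable]: "W \<in> borel_measurable M" and Y[measurable]: "Y \<in> borel_measurable M"
    and int: "\<And>s. integrable M (\<lambda>\<omega>. W \<omega> * exp (s * Y \<omega>))"
  shows integrable_mult_power: "integrable M (\<lambda>\<omega>. W \<omega> * Y \<omega> ^ n)"
    and exp_moment_sums: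
      "(\<lambda>n. (\<integral>\<omega>. W \<omega> * Y \<omega> ^ n \<partial>M) / fact n * s ^ n) sums (\<integral>\<omega>. W \<omega> * exp (s * Y \<omega>) \<partial>M)"
proof -
  have dom: "(\<Sum>j<n. \<bar>u\<bar> ^ j / fact j) \<le> exp u + exp (- u)" for u :: real and n
  proof -
    have "(\<lambda>j. \<bar>u\<bar> ^ j / fact j) sums exp \<bar>u\<bar>"
      using exp_converges[of "\<bar>u\<bar>"] by (simp add: field_simps)
    then have "(\<Sum>j<n. \<bar>u\<bar> ^ j / fact j) \<le> exp \<bar>u\<bar>"
      using sum_le_suminf[of "\<lambda>j. \<bar>u\<bar> ^ j / fact j" "{..<n}"] by (auto simp: sums_iff)
    also have "\<dots> \<le> exp u + exp (- u)"
      by (cases "u \<ge> 0") auto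
    finally show ?thesis .
  qed
  have int': "integrable M (\<lambda>\<omega>. \<bar>W \<omega> * exp (s * Y \<omega>)\<bar> + \<bar>W \<omega> * exp (- s * Y \<omega>)\<bar>)" for s
    by (intro Bochner_Integration.integrable_add integrable_abs int)
  show pow: "integrable M (\<lambda>\<omega>. W \<omega> * Y \<omega> ^ n)" for n
  proof -
    have "integrable M (\<lambda>\<omega>. fact n * (\<bar>W \<omega> * exp (1 * Y \<omega>)\<bar> + \<bar>W \<omega> * exp (- 1 * Y \<omega>)\<bar>))"
      by (intro integrable_mult_right int')
    then show ?thesis
    proof (rule Bochner_Integration.integrable_bound)
      show "AE \<omega> in M. norm (W \<omega> * Y \<omega> ^ n)
          \<le> norm (fact n * (\<bar>W \<omega> * exp (1 * Y \<omega>)\<bar> + \<bar>W \<omega> * exp (- 1 * Y \<omega>)\<bar>))"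
      proof (rule AE_I2)
        fix \<omega>
        have "\<bar>Y \<omega>\<bar> ^ n / fact n \<le> (\<Sum>j<Suc n. \<bar>Y \<omega>\<bar> ^ j / fact j)"
          by (intro member_le_sum) auto
        also note dom
        finally have "\<bar>Y \<omega>\<bar> ^ n \<le> fact n * (exp (Y \<omega>) + exp (- Y \<omega>))"
          by (simp add: field_simps)
        from mult_left_mono[OF this, of "\<bar>W \<omega>\<bar>"]
        show "norm (W \<omega> * Y \<omega> ^ n)
          \<le> norm (fact n * (\<bar>W \<omega> * exp (1 * Y \<omega>)\<bar> + \<bar>W \<omega> * exp (- 1 * Y \<omega>)\<bar>))"
          by (simp add: abs_mult power_abs algebra_simps)
      qed
    qed simp
  qed
  have "(\<lambda>n. \<integral>\<omega>. (\<Sum>j<n. W \<omega> * (s * Y \<omega>) ^ j / fact j) \<partial>M)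
      \<longlonglongrightarrow> (\<integral>\<omega>. W \<omega> * exp (s * Y \<omega>) \<partial>M)"
  proof (rule integral_dominated_convergence[OF _ _ int'[of s]])
    show "AE \<omega> in M. (\<lambda>n. \<Sum>j<n. W \<omega> * (s * Y \<omega>) ^ j / fact j) \<longlonglongrightarrow> W \<omega> * exp (s * Y \<omega>)"
    proof (rule AE_I2)
      fix \<omega>
      show "(\<lambda>n. \<Sum>j<n. W \<omega> * (s * Y \<omega>) ^ j / fact j) \<longlonglongrightarrow> W \<omega> * exp (s * Y \<omega>)"
        using sums_mult[OF exp_converges[of "s * Y \<omega>"], of "W \<omega>"]
        by (simp add: sums_def field_simps)
    qed
    fix n
    show "AE \<omega> in M. norm (\<Sum>j<n. W \<omega> * (s * Y \<omega>) ^ j / fact j)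
        \<le> \<bar>W \<omega> * exp (s * Y \<omega>)\<bar> + \<bar>W \<omega> * exp (- s * Y \<omega>)\<bar>"
    proof (rule AE_I2)
      fix \<omega>
      have "norm (\<Sum>j<n. W \<omega> * (s * Y \<omega>) ^ j / fact j)
          \<le> (\<Sum>j<n. norm (W \<omega> * (s * Y \<omega>) ^ j / fact j))"
        by (rule norm_sum)
      also have "\<dots> = \<bar>W \<omega>\<bar> * (\<Sum>j<n. \<bar>s * Y \<omega>\<bar> ^ j / fact j)"
        by (simp add: sum_distrib_left abs_mult power_abs)
      also have "\<dots> \<le> \<bar>W \<omega>\<bar> * (exp (s * Y \<omega>) + exp (- (s * Y \<omega>)))"
        by (intro mult_left_mono dom) auto
      finally show "norm (\<Sum>j<n. W \<omega> * (s * Y \<omega>) ^ j / fact j)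
        \<le> \<bar>W \<omega> * exp (s * Y \<omega>)\<bar> + \<bar>W \<omega> * exp (- s * Y \<omega>)\<bar>"
        by (simp add: abs_mult algebra_simps)
    qed
  qed auto
  moreover have "(\<integral>\<omega>. (\<Sum>j<n. W \<omega> * (s * Y \<omega>) ^ j / fact j) \<partial>M)
      = (\<Sum>j<n. (\<integral>\<omega>. W \<omega> * Y \<omega> ^ j \<partial>M) / fact j * s ^ j)" for n
  proof -
    have eq: "W \<omega> * (s * Y \<omega>) ^ j / fact j = s ^ j / fact j * (W \<omega> * Y \<omega> ^ j)" for \<omega> j
      by (simp add: power_mult_distrib)
    show ?thesis
      unfolding eq by (subst Bochner_Integration.integral_sum) (simp_all add: pow mult.commute)
  qed
  ultimately show "(\<lambda>n. (\<integral>\<omega>. W \<omega> * Y \<omega> ^ n \<partial>M) / fact n * s ^ n)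
      sums (\<integral>\<omega>. W \<omega> * exp (s * Y \<omega>) \<partial>M)"
    by (simp add: sums_def)
qed

text \<open>Once the coefficients below \<open>n\<close> agree, the difference series can be divided
  by \<open>x ^ n\<close> for \<open>x \<noteq> 0\<close>; its limit at 0 is the difference of the
  coefficients at \<open>n\<close>.\<close>

lemma powser_coeffs_unique:
  fixes u v :: "nat \<Rightarrow> real"
  assumes u: "\<And>s. (\<lambda>n. u n * s ^ n) sums f s" and v: "\<And>s. (\<lambda>n. v n * s ^ n) sums f s"
  shows "u n = v n"
proof (induction n rule: less_induct)
  case (less n)
  have "(\<lambda>j. (u (j + n) - v (j + n)) * x ^ j) sums 0" if "x \<noteq> 0" for x
  proof -
    have "(\<lambda>j. (u j - v j) * x ^ j) sums 0"
      using sums_diff[OF u[of x] v[of x]] by (simp add: left_diff_distrib)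
    then have "(\<lambda>j. (u (j + n) - v (j + n)) * x ^ (j + n)) sums 0"
      using less by (subst sums_zero_iff_shift) auto
    from sums_divide[OF this, of "x ^ n"] show ?thesis
      using that by (simp add: power_add)
  qed
  then have "((\<lambda>x::real. 0 :: real) \<longlongrightarrow> u (0 + n) - v (0 + n)) (at 0)"
    by (rule powser_limit_0_strong[OF zero_less_one])
  then show ?case
    using tendsto_unique[OF trivial_limit_at, of "\<lambda>x. 0" _ "0::real"] tendsto_const by fastforce
qed

text \<open>
  The weight \<open>W\<close> is what makes the induction on \<open>I\<close> go through: comparing coefficients in one variable
  \<open>S i\<close> replaces \<open>W\<close> by \<open>W * Y i ^ n\<close> and leaves a power series in the remaining variables.
\<close>

lemma moments_from_mgf:
  fixes Y :: "'i \<Rightarrow> 'a \<Rightarrow> real" and c :: "('i \<Rightarrow> nat) \<Rightarrow> real"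
  assumes "finite I" and "W \<in> borel_measurable M" and "\<And>i. i \<in> I \<Longrightarrow> Y i \<in> borel_measurable M"
    and "\<And>S. integrable M (\<lambda>\<omega>. W \<omega> * exp (\<Sum>i\<in>I. S i * Y i \<omega>))"
    and "\<And>S. ((\<lambda>k. c k * (\<Prod>i\<in>I. S i ^ k i)) has_sum
               (\<integral>\<omega>. W \<omega> * exp (\<Sum>i\<in>I. S i * Y i \<omega>) \<partial>M)) (\<Pi>\<^sub>E i\<in>I. UNIV)"
    and "k \<in> (\<Pi>\<^sub>E i\<in>I. UNIV)"
  shows "integrable M (\<lambda>\<omega>. W \<omega> * (\<Prod>i\<in>I. Y i \<omega> ^ k i)) \<and>
         (\<integral>\<omega>. W \<omega> * (\<Prod>i\<in>I. Y i \<omega> ^ k i) \<partial>M) = c k * (\<Prod>i\<in>I. fact (k i))"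
  using assms
proof (induction I arbitrary: W c k rule: finite_induct)
  case empty
  then have "k = (\<lambda>_. undefined)" by auto
  with empty.prems(4)[of undefined] empty.prems(3) show ?case
    by (simp add: has_sum_finite_iff)
next
  case (insert i I)
  note [measurable] = insert.prems(1,2)
  have [measurable]: "Y i \<in> borel_measurable M" "\<And>j. j \<in> I \<Longrightarrow> Y j \<in> borel_measurable M"
    using insert.prems(2) by auto
  define n where "n = k i"
  define k' where "k' = restrict k I"
  have k: "k = k'(i := n)"
    using insert.prems(5) by (auto simp: k'_def n_def fun_eq_iff PiE_def extensional_def)
  have k'P: "k' \<in> (\<Pi>\<^sub>E i\<in>I. UNIV)" by (auto simp: k'_def)
  define V where "V = (\<lambda>S \<omega>. W \<omega> * exp (\<Sum>j\<in>I. S j * Y j \<omega>))"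
  have [measurable]: "V S \<in> borel_measurable M" for S
    unfolding V_def by measurable
  have Veq: "W \<omega> * exp (\<Sum>j\<in>insert i I. (S(i := s)) j * Y j \<omega>) = V S \<omega> * exp (s * Y i \<omega>)" for S s \<omega>
  proof -
    have "(\<Sum>j\<in>I. (S(i := s)) j * Y j \<omega>) = (\<Sum>j\<in>I. S j * Y j \<omega>)"
      using insert.hyps by (intro sum.cong) auto
    then show ?thesis
      using insert.hyps by (simp add: V_def exp_add mult_ac)
  qed
  have Vint: "integrable M (\<lambda>\<omega>. V S \<omega> * exp (s * Y i \<omega>))" for S s
    using insert.prems(3)[of "S(i := s)"] by (simp only: Veq)
  define F where "F = (\<lambda>S n k'. c (k'(i := n)) * (\<Prod>j\<in>I. S j ^ k' j))"
  \<comment> \<open>A multi-index on \<open>insert i I\<close> is split into its value at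
    \<open>i\<close> and its restriction to \<open>I\<close>, so that the sum can be iterated with
    the power of \<open>s\<close> outside.\<close>
  have hs: "((\<lambda>(n, k'). s ^ n * F S n k') has_sum (\<integral>\<omega>. V S \<omega> * exp (s * Y i \<omega>) \<partial>M))
      (UNIV \<times> (\<Pi>\<^sub>E i\<in>I. UNIV))" for S s
  proof -
    have inj: "inj_on (\<lambda>(y :: nat, g). g(i := y)) (UNIV \<times> (\<Pi>\<^sub>E i\<in>I. UNIV))"
      by (rule inj_combinator[OF insert.hyps(2)])
    have "((\<lambda>k. c k * (\<Prod>j\<in>insert i I. (S(i := s)) j ^ k j)) has_sum
        (\<integral>\<omega>. V S \<omega> * exp (s * Y i \<omega>) \<partial>M))
        ((\<lambda>(y, g). g(i := y)) ` (UNIV \<times> (\<Pi>\<^sub>E i\<in>I. UNIV)))"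
      using insert.prems(4)[of "S(i := s)"] by (simp only: Veq PiE_insert_eq)
    then have "((\<lambda>k. c k * (\<Prod>j\<in>insert i I. (S(i := s)) j ^ k j)) \<circ> (\<lambda>(y, g). g(i := y)) has_sum
        (\<integral>\<omega>. V S \<omega> * exp (s * Y i \<omega>) \<partial>M)) (UNIV \<times> (\<Pi>\<^sub>E i\<in>I. UNIV))"
      by (subst (asm) has_sum_reindex[OF inj])
    moreover have "(\<lambda>k. c k * (\<Prod>j\<in>insert i I. (S(i := s)) j ^ k j)) \<circ> (\<lambda>(y, g). g(i := y)) =
        (\<lambda>(n, k'). s ^ n * F S n k')"
    proof (rule ext, clarify)
      fix n :: nat and g :: "'i \<Rightarrow> nat"
      have "(\<Prod>j\<in>I. (S(i := s)) j ^ (g(i := n)) j) = (\<Prod>j\<in>I. S j ^ g j)"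
        using insert.hyps by (intro prod.cong) auto
      then show "((\<lambda>k. c k * (\<Prod>j\<in>insert i I. (S(i := s)) j ^ k j)) \<circ> (\<lambda>(y, g). g(i := y))) (n, g)
          = s ^ n * F S n g"
        using insert.hyps by (simp add: F_def)
    qed
    ultimately show ?thesis by simp
  qed
  \<comment> \<open>Summability of a slice does not involve \<open>s\<close>; the choice
    \<open>s = 1\<close> removes the factor \<open>s ^ n\<close>, which could vanish for other
    values.\<close>
  have sumF: "F S n summable_on (\<Pi>\<^sub>E i\<in>I. UNIV)" for S n
    using summable_on_SigmaD1[OF has_sum_imp_summable[OF hs[of 1 S]], of n] by simp
  have inner: "((\<lambda>k'. s ^ n * F S n k') has_sum (s ^ n * infsum (F S n) (\<Pi>\<^sub>E i\<in>I. UNIV)))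
      (\<Pi>\<^sub>E i\<in>I. UNIV)" for S s n
    by (intro has_sum_cmult_right has_sum_infsum sumF)
  have outer: "(\<lambda>n. infsum (F S n) (\<Pi>\<^sub>E i\<in>I. UNIV) * s ^ n) sums (\<integral>\<omega>. V S \<omega> * exp (s * Y i \<omega>) \<partial>M)" for S s
  proof -
    have "((\<lambda>n. s ^ n * infsum (F S n) (\<Pi>\<^sub>E i\<in>I. UNIV)) has_sum
        (\<integral>\<omega>. V S \<omega> * exp (s * Y i \<omega>) \<partial>M)) UNIV"
      by (rule has_sum_SigmaD[OF hs[of s S]]) (simp add: inner)
    from has_sum_imp_sums[OF this] show ?thesis
      by (simp add: mult.commute)
  qed
  have coeff: "(\<integral>\<omega>. V S \<omega> * Y i \<omega> ^ n \<partial>M) = fact n * infsum (F S n) (\<Pi>\<^sub>E i\<in>I. UNIV)" for S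
    using powser_coeffs_unique[OF exp_moment_sums[OF _ _ Vint] outer, of S n]
    by (simp add: field_simps)
  have "integrable M (\<lambda>\<omega>. W \<omega> * Y i \<omega> ^ n * (\<Prod>j\<in>I. Y j \<omega> ^ k' j)) \<and>
        (\<integral>\<omega>. W \<omega> * Y i \<omega> ^ n * (\<Prod>j\<in>I. Y j \<omega> ^ k' j) \<partial>M)
          = fact n * c (k'(i := n)) * (\<Prod>j\<in>I. fact (k' j))"
  proof (rule insert.IH)
    fix S
    have VY: "W \<omega> * Y i \<omega> ^ n * exp (\<Sum>j\<in>I. S j * Y j \<omega>) = V S \<omega> * Y i \<omega> ^ n" for \<omega>
      by (simp add: V_def mult_ac)
    show "integrable M (\<lambda>\<omega>. W \<omega> * Y i \<omega> ^ n * exp (\<Sum>j\<in>I. S j * Y j \<omega>))"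
      unfolding VY by (intro integrable_mult_power Vint) auto
    show "((\<lambda>k. fact n * c (k(i := n)) * (\<Prod>i\<in>I. S i ^ k i)) has_sum
        (\<integral>\<omega>. W \<omega> * Y i \<omega> ^ n * exp (\<Sum>j\<in>I. S j * Y j \<omega>) \<partial>M)) (\<Pi>\<^sub>E i\<in>I. UNIV)"
      using has_sum_cmult_right[OF has_sum_infsum[OF sumF[of S n]], of "fact n"]
      unfolding VY coeff by (simp add: F_def mult_ac)
  qed (use k'P in auto)
  moreover have "(\<Prod>j\<in>I. Y j \<omega> ^ k j) = (\<Prod>j\<in>I. Y j \<omega> ^ k' j)" for \<omega>
    by (simp add: k'_def)
  moreover have "(\<Prod>j\<in>I. fact (k j)) = (\<Prod>j\<in>I. fact (k' j) :: real)"
    by (simp add: k'_def)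
  ultimately show ?case
    using insert.hyps by (simp add: n_def[symmetric] k[symmetric] mult_ac)
qed

subsection \<open>The integrals \<open>exp_A\<close>\<close>

lemma nn_integral_indicator_greaterThanLessThan_FTC:
  fixes f F :: "real \<Rightarrow> real"
  assumes "f \<in> borel_measurable borel" and "\<And>x. x \<in> {a..b} \<Longrightarrow> (F has_real_derivative f x) (at x)"
    and "\<And>x. x \<in> {a..b} \<Longrightarrow> 0 \<le> f x" and "a \<le> b"
  shows "(\<integral>\<^sup>+x. indicator {a<..<b} x * ennreal (f x) \<partial>lborel) = ennreal (F b - F a)"
proof -
  have "(\<integral>\<^sup>+x. indicator {a<..<b} x * ennreal (f x) \<partial>lborel)
      = (\<integral>\<^sup>+x. ennreal (f x) * indicator {a..b} x \<partial>lborel)"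
    using AE_lborel_singleton[of a] AE_lborel_singleton[of b]
    by (intro nn_integral_cong_AE) (auto split: split_indicator)
  also have "\<dots> = ennreal (F b - F a)"
  proof (rule nn_integral_FTC_Icc)
  qed (use assms in \<open>auto simp: has_real_derivative_iff_has_vector_derivative
          intro: has_vector_derivative_at_within\<close>)
  finally show ?thesis .
qed

text \<open>The kernel is \<open>(x - y) ^ (k - 2) / (k - 2)!\<close>, the volume of
  \<open>k - 2\<close> ordered points between \<open>y\<close> and \<open>x\<close>. Integrating
  over the extreme points too gives the volume of the simplex of \<open>k\<close> ordered points in
  the interval from \<open>l\<close> to \<open>u\<close>.\<close>

lemma nn_integral_triangle_power:
  fixes l u :: real
  assumes "l \<le> u" and k: "k \<ge> 2"
  shows "(\<integral>\<^sup>+y. \<integral>\<^sup>+x. indicator {p. l < snd p \<and> snd p < fst p \<and> fst p < u} (x, y)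
            * ennreal ((x - y) ^ (k - 2) / Gamma (real k - 1)) \<partial>lborel \<partial>lborel)
         = ennreal ((u - l) ^ k / fact k)"
proof -
  obtain n where n: "k = Suc (Suc n)"
    using k by (metis Suc_le_D numeral_2_eq_2 Suc_le_mono)
  have "real k - 1 = 1 + real n" by (simp add: n)
  then have G: "Gamma (real k - 1) = fact n"
    by (simp only: Gamma_fact)
  have kernel: "(x - y) ^ (k - 2) / Gamma (real k - 1) = (x - y) ^ n / fact n" for x y
    unfolding G by (simp add: n)
  have inner: "(\<integral>\<^sup>+x. indicator {p. l < snd p \<and> snd p < fst p \<and> fst p < u} (x, y)
            * ennreal ((x - y) ^ (k - 2) / Gamma (real k - 1)) \<partial>lborel)
      = indicator {l<..<u} y * ennreal ((u - y) ^ Suc n / fact (Suc n))" for y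
  proof (cases "y \<in> {l<..<u}")
    case True
    have "(\<integral>\<^sup>+x. indicator {p. l < snd p \<and> snd p < fst p \<and> fst p < u} (x, y)
            * ennreal ((x - y) ^ (k - 2) / Gamma (real k - 1)) \<partial>lborel)
        = (\<integral>\<^sup>+x. indicator {y<..<u} x * ennreal ((x - y) ^ n / fact n) \<partial>lborel)"
      unfolding kernel using True by (intro nn_integral_cong) (auto split: split_indicator)
    also have "\<dots> = ennreal ((u - y) ^ Suc n / fact (Suc n) - (y - y) ^ Suc n / fact (Suc n))"
      using True
      by (intro nn_integral_indicator_greaterThanLessThan_FTC)
        (auto intro!: derivative_eq_intros simp del: power_Suc of_nat_Suc simp: field_simps)
    finally show ?thesis using True by simp
  next
    case False
    then show ?thesis
      by (auto simp: indicator_def intro!: nn_integral_zero' AE_I2)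
  qed
  have "(\<integral>\<^sup>+y. indicator {l<..<u} y * ennreal ((u - y) ^ Suc n / fact (Suc n)) \<partial>lborel)
      = ennreal (- ((u - u) ^ k / fact k) - (- ((u - l) ^ k / fact k)))"
    unfolding n using assms
    by (intro nn_integral_indicator_greaterThanLessThan_FTC)
      (auto intro!: derivative_eq_intros simp del: power_Suc of_nat_Suc simp: field_simps)
  also have "\<dots> = ennreal ((u - l) ^ k / fact k)"
    using n by simp
  finally show ?thesis
    unfolding inner .
qed

text \<open>Tonelli: for fixed second component the integrand is a product over the coordinates in
  \<open>C\<close>, and after that integration a product over those in \<open>D\<close>. Only the
  indices in \<open>D\<close> couple a coordinate of each component.\<close>

lemma nn_integral_pair_PiM_prod:
  fixes g :: "'i \<Rightarrow> 'a \<Rightarrow> ennreal" and h :: "'i \<Rightarrow> 'a \<Rightarrow> 'a \<Rightarrow> ennreal"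
  assumes "sigma_finite_measure N" and fin: "finite C" and D: "D \<subseteq> C"
    and g[measurable]: "\<And>i. g i \<in> borel_measurable N"
    and h[measurable]: "\<And>i. case_prod (h i) \<in> borel_measurable (N \<Otimes>\<^sub>M N)"
  shows "(\<integral>\<^sup>+z. (\<Prod>i\<in>C - D. g i (fst z i)) * (\<Prod>i\<in>D. h i (fst z i) (snd z i))
            \<partial>((\<Pi>\<^sub>M i\<in>C. N) \<Otimes>\<^sub>M (\<Pi>\<^sub>M i\<in>D. N)))
       = (\<Prod>i\<in>C - D. \<integral>\<^sup>+x. g i x \<partial>N) * (\<Prod>i\<in>D. \<integral>\<^sup>+y. \<integral>\<^sup>+x. h i x y \<partial>N \<partial>N)"
proof -
  interpret N: sigma_finite_measure N by fact
  interpret P: product_sigma_finite "\<lambda>_::'i. N" by standard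
  have finD: "finite D" using fin D finite_subset by blast
  interpret C: finite_product_sigma_finite "\<lambda>_::'i. N" C by standard (fact fin)
  interpret D: finite_product_sigma_finite "\<lambda>_::'i. N" D by standard (fact finD)
  interpret pair_sigma_finite "\<Pi>\<^sub>M i\<in>C. N" "\<Pi>\<^sub>M i\<in>D. N" ..
  have split: "prod F C = prod F (C - D) * prod F D" for F :: "'i \<Rightarrow> ennreal"
    using fin D by (metis prod.subset_diff)
  \<comment> \<open>Both kinds of factors are merged into one family over \<open>C\<close>, the form
    required for integrating a product coordinate by coordinate.\<close>
  define f where "f = (\<lambda>i x y. if i \<in> D then h i x y else g i x)"
  have f_meas[measurable]: "(\<lambda>x. f i x y) \<in> borel_measurable N" if "y \<in> space N" for i y
    using that unfolding f_def by (cases "i \<in> D") auto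
  have Cm: "(\<lambda>z. fst z i) \<in> (\<Pi>\<^sub>M i\<in>C. N) \<Otimes>\<^sub>M (\<Pi>\<^sub>M i\<in>D. N) \<rightarrow>\<^sub>M N" if "i \<in> C" for i
    using that by measurable
  have Dm: "(\<lambda>z. snd z i) \<in> (\<Pi>\<^sub>M i\<in>C. N) \<Otimes>\<^sub>M (\<Pi>\<^sub>M i\<in>D. N) \<rightarrow>\<^sub>M N" if "i \<in> D" for i
    using that by measurable
  have meas: "(\<lambda>z. (\<Prod>i\<in>C - D. g i (fst z i)) * (\<Prod>i\<in>D. h i (fst z i) (snd z i)))
      \<in> borel_measurable ((\<Pi>\<^sub>M i\<in>C. N) \<Otimes>\<^sub>M (\<Pi>\<^sub>M i\<in>D. N))"
  proof (intro borel_measurable_times_ennreal borel_measurable_prod_ennreal)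
    show "(\<lambda>z. g i (fst z i)) \<in> borel_measurable ((\<Pi>\<^sub>M i\<in>C. N) \<Otimes>\<^sub>M (\<Pi>\<^sub>M i\<in>D. N))" if "i \<in> C - D" for i
      using measurable_compose[OF Cm g] that by simp
    show "(\<lambda>z. h i (fst z i) (snd z i)) \<in> borel_measurable ((\<Pi>\<^sub>M i\<in>C. N) \<Otimes>\<^sub>M (\<Pi>\<^sub>M i\<in>D. N))"
      if "i \<in> D" for i
      using measurable_compose[OF measurable_Pair[OF Cm Dm] h] that D by auto
  qed
  have "(\<integral>\<^sup>+z. (\<Prod>i\<in>C - D. g i (fst z i)) * (\<Prod>i\<in>D. h i (fst z i) (snd z i))
            \<partial>((\<Pi>\<^sub>M i\<in>C. N) \<Otimes>\<^sub>M (\<Pi>\<^sub>M i\<in>D. N)))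
      = (\<integral>\<^sup>+y. \<integral>\<^sup>+x. (\<Prod>i\<in>C - D. g i (x i)) * (\<Prod>i\<in>D. h i (x i) (y i))
            \<partial>(\<Pi>\<^sub>M i\<in>C. N) \<partial>(\<Pi>\<^sub>M i\<in>D. N))"
    using nn_integral_snd[OF meas] by simp
  also have "\<dots> = (\<integral>\<^sup>+y. (\<Prod>i\<in>C - D. \<integral>\<^sup>+x. g i x \<partial>N) * (\<Prod>i\<in>D. \<integral>\<^sup>+x. h i x (y i) \<partial>N) \<partial>(\<Pi>\<^sub>M i\<in>D. N))"
  proof (rule nn_integral_cong)
    fix y assume y: "y \<in> space (\<Pi>\<^sub>M i\<in>D. N)"
    have "(\<integral>\<^sup>+x. (\<Prod>i\<in>C - D. g i (x i)) * (\<Prod>i\<in>D. h i (x i) (y i)) \<partial>(\<Pi>\<^sub>M i\<in>C. N))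
        = (\<integral>\<^sup>+x. (\<Prod>i\<in>C. f i (x i) (y i)) \<partial>(\<Pi>\<^sub>M i\<in>C. N))"
      by (intro nn_integral_cong) (simp add: split f_def)
    also have "\<dots> = (\<Prod>i\<in>C. \<integral>\<^sup>+x. f i x (y i) \<partial>N)"
    proof (rule P.product_nn_integral_prod[OF fin])
      fix i assume "i \<in> C"
      show "(\<lambda>x. f i x (y i)) \<in> borel_measurable N"
      proof (cases "i \<in> D")
        case True
        then show ?thesis using y by (intro f_meas) (auto simp: space_PiM)
      qed (simp add: f_def)
    qed
    also have "\<dots> = (\<Prod>i\<in>C - D. \<integral>\<^sup>+x. g i x \<partial>N) * (\<Prod>i\<in>D. \<integral>\<^sup>+x. h i x (y i) \<partial>N)"
      by (simp add: split f_def)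
    finally show "(\<integral>\<^sup>+x. (\<Prod>i\<in>C - D. g i (x i)) * (\<Prod>i\<in>D. h i (x i) (y i)) \<partial>(\<Pi>\<^sub>M i\<in>C. N))
        = (\<Prod>i\<in>C - D. \<integral>\<^sup>+x. g i x \<partial>N) * (\<Prod>i\<in>D. \<integral>\<^sup>+x. h i x (y i) \<partial>N)" .
  qed
  also have "\<dots> = (\<Prod>i\<in>C - D. \<integral>\<^sup>+x. g i x \<partial>N) * (\<integral>\<^sup>+y. (\<Prod>i\<in>D. \<integral>\<^sup>+x. h i x (y i) \<partial>N) \<partial>(\<Pi>\<^sub>M i\<in>D. N))"
    by (rule nn_integral_cmult) (auto intro!: borel_measurable_prod_ennreal)
  also have "(\<integral>\<^sup>+y. (\<Prod>i\<in>D. \<integral>\<^sup>+x. h i x (y i) \<partial>N) \<partial>(\<Pi>\<^sub>M i\<in>D. N))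
      = (\<Prod>i\<in>D. \<integral>\<^sup>+y. \<integral>\<^sup>+x. h i x y \<partial>N \<partial>N)"
    by (rule P.product_nn_integral_prod[OF finD]) auto
  finally show ?thesis .
qed

text \<open>
  Up to the exponential weight, the integrand of \<open>exp_A\<close> is a product over \<open>i \<in> C\<close>: of \<open>exp_g\<close> for the
  indices with \<open>k i = 1\<close>, which have no variable \<open>x'\<close>, and of \<open>exp_h\<close> for the others.
\<close>

definition exp_g :: "(nat \<Rightarrow> real) \<Rightarrow> nat set \<Rightarrow> nat \<Rightarrow> real \<Rightarrow> ennreal" where
  "exp_g t C i x = indicator {t (i - 1) / t (Max C)<..<t i / t (Max C)} x"

definition exp_h :: "(nat \<Rightarrow> real) \<Rightarrow> nat set \<Rightarrow> (nat \<Rightarrow> nat) \<Rightarrow> nat \<Rightarrow> real \<Rightarrow> real \<Rightarrow> ennreal" where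
  "exp_h t C k i x y =
     indicator {p. t (i - 1) / t (Max C) < snd p \<and> snd p < fst p \<and> fst p < t i / t (Max C)} (x, y)
       * ennreal ((x - y) ^ (k i - 2) / Gamma (real (k i) - 1))"

definition exp_weight :: "real \<Rightarrow> (nat \<Rightarrow> real) \<Rightarrow> nat set \<Rightarrow> (nat \<Rightarrow> nat) \<Rightarrow> (nat \<Rightarrow> real) \<times> (nat \<Rightarrow> real) \<Rightarrow> real" where
  "exp_weight lam t C k z =
     exp (- lam * t (Max C) *
       (fst z (Max C) - (if k (Min C) \<ge> 2 then snd z (Min C) else fst z (Min C))))"

abbreviation exp_measure :: "nat set \<Rightarrow> (nat \<Rightarrow> nat) \<Rightarrow> ((nat \<Rightarrow> real) \<times> (nat \<Rightarrow> real)) measure" where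
  "exp_measure C k \<equiv> (\<Pi>\<^sub>M i\<in>C. lborel) \<Otimes>\<^sub>M (\<Pi>\<^sub>M i\<in>exp_C2 C k. lborel)"

lemma exp_g_measurable[measurable]: "exp_g t C i \<in> borel_measurable borel"
  unfolding exp_g_def by measurable

lemma exp_h_measurable[measurable]: "case_prod (exp_h t C k i) \<in> borel_measurable (borel \<Otimes>\<^sub>M borel)"
proof -
  have "{p :: real \<times> real. a < snd p \<and> snd p < fst p \<and> fst p < b} \<in> sets (borel \<Otimes>\<^sub>M borel)" for a b
  proof -
    have "Measurable.pred (borel \<Otimes>\<^sub>M borel) (\<lambda>p :: real \<times> real. a < snd p \<and> snd p < fst p \<and> fst p < b)"
      by measurable
    then show ?thesis by (simp add: pred_def space_pair_measure)
  qed
  then show ?thesis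
    unfolding exp_h_def case_prod_beta prod.collapse by measurable
qed

text \<open>The coordinate \<open>snd z (Min C)\<close> occurs in the weight only under this
  condition, and its measurability requires \<open>Min C\<close> to be an index of the second
  product.\<close>

lemma Min_in_exp_C2:
  assumes "finite C" "C \<noteq> {}" "k (Min C) \<ge> 2"
  shows "Min C \<in> exp_C2 C k"
  using assms by (auto simp: exp_C2_def)

lemma exp_weight_measurable[measurable]:
  assumes "finite C" "C \<noteq> {}"
  shows "exp_weight lam t C k \<in> borel_measurable (exp_measure C k)"
proof -
  have C: "(\<lambda>z. fst z i) \<in> borel_measurable (exp_measure C k)" if "i \<in> C" for i
    using that by measurable
  have D: "(\<lambda>z. snd z i) \<in> borel_measurable (exp_measure C k)" if "i \<in> exp_C2 C k" for i
    using that by measurable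
  have "(\<lambda>z. if k (Min C) \<ge> 2 then snd z (Min C) else fst z (Min C)) \<in> borel_measurable (exp_measure C k)"
    using assms C[of "Min C"] D[OF Min_in_exp_C2[OF assms]] by (cases "k (Min C) \<ge> 2") simp_all
  then show ?thesis
    unfolding exp_weight_def using C[OF Max_in[OF assms]]
    by (intro borel_measurable_times borel_measurable_diff measurable_const
        measurable_compose[OF _ borel_measurable_exp]) auto
qed

lemma exp_C1_eq: "\<forall>i\<in>C. k i \<ge> 1 \<Longrightarrow> C - exp_C2 C k = exp_C1 C k"
  by (force simp: exp_C1_def exp_C2_def)

lemma prod_exp_measurable[measurable]:
  assumes "finite C"
  shows "(\<lambda>z. (\<Prod>i\<in>C - exp_C2 C k. exp_g t C i (fst z i)) * (\<Prod>i\<in>exp_C2 C k. exp_h t C k i (fst z i) (snd z i)))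
      \<in> borel_measurable (exp_measure C k)"
proof -
  have C: "(\<lambda>z. fst z i) \<in> borel_measurable (exp_measure C k)" if "i \<in> C" for i
    using that by measurable
  have D: "(\<lambda>z. snd z i) \<in> borel_measurable (exp_measure C k)" if "i \<in> exp_C2 C k" for i
    using that by measurable
  show ?thesis
  proof (intro borel_measurable_times_ennreal borel_measurable_prod_ennreal)
    show "(\<lambda>z. exp_g t C i (fst z i)) \<in> borel_measurable (exp_measure C k)" if "i \<in> C - exp_C2 C k" for i
      using measurable_compose[OF C exp_g_measurable] that by simp
    show "(\<lambda>z. exp_h t C k i (fst z i) (snd z i)) \<in> borel_measurable (exp_measure C k)"
      if "i \<in> exp_C2 C k" for i
      using measurable_compose[OF measurable_Pair[OF C D] exp_h_measurable] that
      by (auto simp: exp_C2_def)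
  qed
qed

lemma prod_exp_eq:
  assumes fin: "finite C" and k: "\<forall>i\<in>C. k i \<ge> 1"
  shows "(\<Prod>i\<in>C - exp_C2 C k. exp_g t C i (fst z i)) * (\<Prod>i\<in>exp_C2 C k. exp_h t C k i (fst z i) (snd z i))
       = ennreal (indicator (exp_Q t C k) z *
           (\<Prod>i\<in>exp_C2 C k. (fst z i - snd z i) ^ (k i - 2) / Gamma (real (k i) - 1)))"
proof (cases "z \<in> exp_Q t C k")
  case True
  have "exp_g t C i (fst z i) = 1" if "i \<in> C - exp_C2 C k" for i
    using True that unfolding exp_C1_eq[OF k] exp_g_def by (cases z) (auto simp: exp_Q_def Let_def)
  moreover have "exp_h t C k i (fst z i) (snd z i)
      = ennreal ((fst z i - snd z i) ^ (k i - 2) / Gamma (real (k i) - 1))" if "i \<in> exp_C2 C k" for i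
    using True that by (auto simp: exp_Q_def Let_def exp_h_def)
  \<comment> \<open>Since \<open>ennreal\<close> sends negative numbers to 0, it commutes with the
    product only for nonnegative factors. Here \<open>x' i < x i\<close> on \<open>exp_Q\<close>,
    and \<open>Gamma\<close> is positive at \<open>k i - 1 \<ge> 1\<close>.\<close>
  moreover have "(fst z i - snd z i) ^ (k i - 2) / Gamma (real (k i) - 1) \<ge> 0" if "i \<in> exp_C2 C k" for i
    using True that
    by (auto simp: exp_Q_def Let_def exp_C2_def intro!: divide_nonneg_nonneg less_imp_le[OF Gamma_real_pos])
  ultimately show ?thesis
    using True by (simp add: prod_ennreal)
next
  case False
  have fin2: "finite (exp_C2 C k)" using fin by (auto simp: exp_C2_def)
  from False consider i where "i \<in> exp_C2 C k"
      "\<not> (t (i - 1) / t (Max C) < snd z i \<and> snd z i < fst z i \<and> fst z i < t i / t (Max C))"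
    | i where "i \<in> C - exp_C2 C k" "\<not> (t (i - 1) / t (Max C) < fst z i \<and> fst z i < t i / t (Max C))"
    unfolding exp_C1_eq[OF k] by (cases z) (auto simp: exp_Q_def Let_def)
  then have "(\<Prod>i\<in>C - exp_C2 C k. exp_g t C i (fst z i)) * (\<Prod>i\<in>exp_C2 C k. exp_h t C k i (fst z i) (snd z i)) = 0"
  proof cases
    case 1
    then have "exp_h t C k i (fst z i) (snd z i) = 0" by (auto simp: exp_h_def)
    with 1 have "(\<Prod>i\<in>exp_C2 C k. exp_h t C k i (fst z i) (snd z i)) = 0"
      using fin2 by (intro prod_zero) auto
    then show ?thesis by simp
  next
    case 2
    then have "exp_g t C i (fst z i) = 0" by (auto simp: exp_g_def)
    with 2 have "(\<Prod>i\<in>C - exp_C2 C k. exp_g t C i (fst z i)) = 0"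
      using fin by (intro prod_zero) auto
    then show ?thesis by simp
  qed
  with False show ?thesis by simp
qed

text \<open>For a nonnegative measurable integrand the Bochner integral is \<open>enn2real\<close>
  of the nonnegative integral even if the latter is infinite, both being 0 then. No integrability
  has to be shown at this stage.\<close>

lemma exp_A_eq_nn_integral:
  assumes fin: "finite C" "C \<noteq> {}" and k: "\<forall>i\<in>C. k i \<ge> 1"
  shows "exp_A lam t C k = enn2real
    (\<integral>\<^sup>+z. (\<Prod>i\<in>C - exp_C2 C k. exp_g t C i (fst z i)) * (\<Prod>i\<in>exp_C2 C k. exp_h t C k i (fst z i) (snd z i))
       * ennreal (exp_weight lam t C k z) \<partial>(exp_measure C k))"
proof -
  define F where "F = (\<lambda>z. (\<Prod>i\<in>C - exp_C2 C k. exp_g t C i (fst z i)) * (\<Prod>i\<in>exp_C2 C k. exp_h t C k i (fst z i) (snd z i))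
       * ennreal (exp_weight lam t C k z))"
  have [measurable]: "F \<in> borel_measurable (exp_measure C k)"
    unfolding F_def using fin by measurable
  have nonneg: "indicator (exp_Q t C k) z *
           (\<Prod>i\<in>exp_C2 C k. (fst z i - snd z i) ^ (k i - 2) / Gamma (real (k i) - 1)) \<ge> 0" for z
    by (auto simp: exp_Q_def Let_def exp_C2_def split: split_indicator
        intro!: prod_nonneg divide_nonneg_nonneg less_imp_le[OF Gamma_real_pos])
  have F: "F z = ennreal (indicator (exp_Q t C k) z *
           (\<Prod>i\<in>exp_C2 C k. (fst z i - snd z i) ^ (k i - 2) / Gamma (real (k i) - 1)) * exp_weight lam t C k z)" for z
    unfolding F_def prod_exp_eq[OF fin(1) k]
    by (rule ennreal_mult[symmetric]) (use nonneg in \<open>auto simp: exp_weight_def\<close>)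
  have F_real: "enn2real (F z) = indicator (exp_Q t C k) z *
           (\<Prod>i\<in>exp_C2 C k. (fst z i - snd z i) ^ (k i - 2) / Gamma (real (k i) - 1)) * exp_weight lam t C k z" for z
    unfolding F by (intro enn2real_ennreal mult_nonneg_nonneg nonneg) (simp add: exp_weight_def)
  have "exp_A lam t C k = (\<integral>z. enn2real (F z) \<partial>(exp_measure C k))"
    unfolding exp_A_def set_lebesgue_integral_def
    by (intro Bochner_Integration.integral_cong refl)
      (simp add: F_real exp_weight_def case_prod_beta)
  also have "\<dots> = enn2real (\<integral>\<^sup>+z. ennreal (enn2real (F z)) \<partial>(exp_measure C k))"
    by (rule integral_eq_nn_integral) auto
  also have "(\<lambda>z. ennreal (enn2real (F z))) = F"
    by (auto simp: F)
  finally show ?thesis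
    unfolding F_def .
qed

text \<open>Each index contributes the volume of a simplex of \<open>k i\<close> ordered points; for
  \<open>k i = 1\<close> this is the length of the interval, so a single formula serves
  \<open>exp_g\<close> and \<open>exp_h\<close>.\<close>

lemma nn_integral_prod_exp:
  assumes fin: "finite C" and k: "\<forall>i\<in>C. k i \<ge> 1"
    and t: "\<forall>i\<in>C. t (i - 1) \<le> t i" and pos: "t (Max C) > 0"
  shows "(\<integral>\<^sup>+z. (\<Prod>i\<in>C - exp_C2 C k. exp_g t C i (fst z i)) * (\<Prod>i\<in>exp_C2 C k. exp_h t C k i (fst z i) (snd z i))
      \<partial>(exp_measure C k)) = ennreal (\<Prod>i\<in>C. ((t i - t (i - 1)) / t (Max C)) ^ k i / fact (k i))"
proof -
  have sub: "exp_C2 C k \<subseteq> C" by (auto simp: exp_C2_def)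
  have le: "t (i - 1) / t (Max C) \<le> t i / t (Max C)" if "i \<in> C" for i
    using t that pos by (simp add: divide_right_mono)
  have g: "(\<integral>\<^sup>+x. exp_g t C i x \<partial>lborel) = ennreal (((t i - t (i - 1)) / t (Max C)) ^ k i / fact (k i))"
    if "i \<in> C - exp_C2 C k" for i
    using that le[of i] unfolding exp_C1_eq[OF k] exp_g_def
    by (auto simp: exp_C1_def diff_divide_distrib)
  have h: "(\<integral>\<^sup>+y. \<integral>\<^sup>+x. exp_h t C k i x y \<partial>lborel \<partial>lborel)
      = ennreal (((t i - t (i - 1)) / t (Max C)) ^ k i / fact (k i))" if "i \<in> exp_C2 C k" for i
    unfolding exp_h_def using that le[of i]
    by (subst nn_integral_triangle_power) (auto simp: exp_C2_def diff_divide_distrib)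
  have "(\<integral>\<^sup>+z. (\<Prod>i\<in>C - exp_C2 C k. exp_g t C i (fst z i)) * (\<Prod>i\<in>exp_C2 C k. exp_h t C k i (fst z i) (snd z i))
      \<partial>(exp_measure C k))
    = (\<Prod>i\<in>C - exp_C2 C k. \<integral>\<^sup>+x. exp_g t C i x \<partial>lborel) * (\<Prod>i\<in>exp_C2 C k. \<integral>\<^sup>+y. \<integral>\<^sup>+x. exp_h t C k i x y \<partial>lborel \<partial>lborel)"
  proof (rule nn_integral_pair_PiM_prod[OF _ fin sub])
    show "sigma_finite_measure (lborel :: real measure)" by standard
    show "case_prod (exp_h t C k i) \<in> borel_measurable (lborel \<Otimes>\<^sub>M lborel)" for i
      by measurable
  qed measurable
  also have "\<dots> = (\<Prod>i\<in>C - exp_C2 C k. ennreal (((t i - t (i - 1)) / t (Max C)) ^ k i / fact (k i)))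
      * (\<Prod>i\<in>exp_C2 C k. ennreal (((t i - t (i - 1)) / t (Max C)) ^ k i / fact (k i)))"
    by (intro arg_cong2[where f = "(*)"] prod.cong refl g h)
  also have "\<dots> = (\<Prod>i\<in>C. ennreal (((t i - t (i - 1)) / t (Max C)) ^ k i / fact (k i)))"
    by (rule prod.subset_diff[OF sub fin, symmetric])
  also have "\<dots> = ennreal (\<Prod>i\<in>C. ((t i - t (i - 1)) / t (Max C)) ^ k i / fact (k i))"
    using t pos by (intro prod_ennreal) (simp add: zero_le_power)
  finally show ?thesis .
qed

text \<open>The unweighted integrand has a known finite total mass, so bounds of the weight on
  \<open>exp_Q\<close> become bounds of the integral.\<close>

lemma exp_A_bounds:
  assumes fin: "finite C" "C \<noteq> {}" and k: "\<forall>i\<in>C. k i \<ge> 1"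
    and t: "\<forall>i\<in>C. t (i - 1) \<le> t i" and pos: "t (Max C) > 0" and L: "0 \<le> L" "0 \<le> U"
    and weight: "\<And>z. z \<in> exp_Q t C k \<Longrightarrow> L \<le> exp_weight lam t C k z \<and> exp_weight lam t C k z \<le> U"
  shows "(\<Prod>i\<in>C. ((t i - t (i - 1)) / t (Max C)) ^ k i / fact (k i)) * L \<le> exp_A lam t C k"
    and "exp_A lam t C k \<le> (\<Prod>i\<in>C. ((t i - t (i - 1)) / t (Max C)) ^ k i / fact (k i)) * U"
proof -
  define P where "P = (\<lambda>z. (\<Prod>i\<in>C - exp_C2 C k. exp_g t C i (fst z i)) * (\<Prod>i\<in>exp_C2 C k. exp_h t C k i (fst z i) (snd z i)))"
  define V where "V = (\<Prod>i\<in>C. ((t i - t (i - 1)) / t (Max C)) ^ k i / fact (k i))"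
  have [measurable]: "P \<in> borel_measurable (exp_measure C k)"
    unfolding P_def by (rule prod_exp_measurable[OF fin(1)])
  have V: "0 \<le> V"
    unfolding V_def using t pos by (intro prod_nonneg) (simp add: zero_le_power)
  have int: "(\<integral>\<^sup>+z. P z * ennreal c \<partial>exp_measure C k) = ennreal (V * c)" if "c \<ge> 0" for c
  proof -
    have "(\<integral>\<^sup>+z. P z * ennreal c \<partial>exp_measure C k) = (\<integral>\<^sup>+z. P z \<partial>exp_measure C k) * ennreal c"
      by (rule nn_integral_multc) measurable
    also have "(\<integral>\<^sup>+z. P z \<partial>exp_measure C k) = ennreal V"
      unfolding P_def V_def by (rule nn_integral_prod_exp[OF fin(1) k t pos])
    finally show ?thesis
      using that V by (simp add: ennreal_mult)
  qed
  have P0: "P z = 0" if "z \<notin> exp_Q t C k" for z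
    unfolding P_def using that by (subst prod_exp_eq[OF fin(1) k]) auto
  have A: "exp_A lam t C k = enn2real (\<integral>\<^sup>+z. P z * ennreal (exp_weight lam t C k z) \<partial>exp_measure C k)"
    unfolding P_def by (rule exp_A_eq_nn_integral[OF fin k])
  have up: "(\<integral>\<^sup>+z. P z * ennreal (exp_weight lam t C k z) \<partial>exp_measure C k) \<le> ennreal (V * U)"
    unfolding int[OF L(2), symmetric]
  proof (rule nn_integral_mono)
    fix z show "P z * ennreal (exp_weight lam t C k z) \<le> P z * ennreal U"
      using weight[of z] P0[of z]
      by (cases "z \<in> exp_Q t C k") (auto intro!: mult_left_mono ennreal_leI)
  qed
  have lo: "ennreal (V * L) \<le> (\<integral>\<^sup>+z. P z * ennreal (exp_weight lam t C k z) \<partial>exp_measure C k)"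
    unfolding int[OF L(1), symmetric]
  proof (rule nn_integral_mono)
    fix z show "P z * ennreal L \<le> P z * ennreal (exp_weight lam t C k z)"
      using weight[of z] P0[of z]
      by (cases "z \<in> exp_Q t C k") (auto intro!: mult_left_mono ennreal_leI)
  qed
  \<comment> \<open>\<open>enn2real\<close> is monotone only below a finite value. The upper bound
    \<open>up\<close> supplies the finiteness that the lower bound needs.\<close>
  show "V * L \<le> exp_A lam t C k" "exp_A lam t C k \<le> V * U"
    unfolding A using enn2real_mono[OF up] enn2real_mono[OF lo] V L le_less_trans[OF up]
    by (auto simp: enn2real_ennreal)
qed

text \<open>With two distinct indices and no variables \<open>x'\<close> the weight is a product of
  a function of \<open>x p\<close> and a function of \<open>x q\<close>, so the integral is a
  product of two elementary ones. The factor \<open>t q ^ 2\<close> undoes the rescaling of both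
  variables by \<open>t q\<close>.\<close>

lemma exp_A_pair:
  assumes pq: "p < q" and k: "k p = 1" "k q = 1" and lam: "lam > 0"
    and t: "t (p - 1) \<le> t p" "t (q - 1) \<le> t q" and pos: "t q > 0"
  shows "t q ^ 2 * exp_A lam t {p, q} k
    = (exp (lam * t p) - exp (lam * t (p - 1))) * (exp (- lam * t (q - 1)) - exp (- lam * t q)) / lam\<^sup>2"
proof -
  let ?C = "{p, q}"
  let ?N = "(\<Pi>\<^sub>M i\<in>?C. lborel) \<Otimes>\<^sub>M (\<Pi>\<^sub>M i\<in>({} :: nat set). lborel :: real measure)"
  have C2: "exp_C2 ?C k = {}" using k by (auto simp: exp_C2_def)
  have Mm: "Max ?C = q" "Min ?C = p" using pq by auto
  \<comment> \<open>The weight is \<open>exp (lam * t q * x p) * exp (- lam * t q * x q)\<close>: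
    the smallest variable carries \<open>lam\<close>, the largest \<open>- lam\<close>.\<close>
  define g where "g = (\<lambda>i x. exp_g t ?C i x * ennreal (exp ((if i = p then lam else - lam) * t q * x)))"
  have int: "(\<integral>\<^sup>+x. indicator {l / t q<..<u / t q} x * ennreal (exp (c * t q * x)) \<partial>lborel)
      = ennreal ((exp (c * u) - exp (c * l)) / (c * t q))" if "c \<noteq> 0" "l \<le> u" for c l u
  proof -
    have "(\<integral>\<^sup>+x. indicator {l / t q<..<u / t q} x * ennreal (exp (c * t q * x)) \<partial>lborel)
      = ennreal (exp (c * t q * (u / t q)) / (c * t q) - exp (c * t q * (l / t q)) / (c * t q))"
      using that pos
      by (intro nn_integral_indicator_greaterThanLessThan_FTC)
        (auto intro!: derivative_eq_intros divide_right_mono)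
    then show ?thesis using pos by (simp add: diff_divide_distrib)
  qed
  \<comment> \<open>The second product measure has empty index set, so the general product formula
    is used with \<open>D = {}\<close> and a dummy family \<open>h\<close>.\<close>
  have "(\<integral>\<^sup>+z. (\<Prod>i\<in>?C - {}. g i (fst z i)) * (\<Prod>i\<in>({} :: nat set). 1)
            \<partial>?N)
      = (\<Prod>i\<in>?C - {}. \<integral>\<^sup>+x. g i x \<partial>lborel) * (\<Prod>i\<in>({} :: nat set). \<integral>\<^sup>+(y::real). \<integral>\<^sup>+(x::real). 1 \<partial>lborel \<partial>lborel)"
  proof (rule nn_integral_pair_PiM_prod[where h = "\<lambda>_ _ _. 1"])
    show "sigma_finite_measure (lborel :: real measure)" by standard
    show "g i \<in> borel_measurable lborel" for i unfolding g_def by measurable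
  qed auto
  also have "\<dots> = (\<integral>\<^sup>+x. g p x \<partial>lborel) * (\<integral>\<^sup>+x. g q x \<partial>lborel)"
    using pq by simp
  also have "\<dots> = ennreal ((exp (lam * t p) - exp (lam * t (p - 1))) / (lam * t q))
      * ennreal ((exp (- lam * t q) - exp (- lam * t (q - 1))) / (- lam * t q))"
    using pq lam t unfolding g_def exp_g_def Mm by (simp only: int if_True if_False refl) (subst int; auto)
  \<comment> \<open>The second factor is nonnegative because its numerator is nonpositive and its
    denominator negative.\<close>
  also have "\<dots> = ennreal ((exp (lam * t p) - exp (lam * t (p - 1))) / (lam * t q) *
       ((exp (- lam * t q) - exp (- lam * t (q - 1))) / (- lam * t q)))"
    using lam t pos by (intro ennreal_mult[symmetric] divide_nonneg_pos divide_nonpos_neg) auto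
  finally have *: "(\<integral>\<^sup>+z. (\<Prod>i\<in>?C. g i (fst z i)) \<partial>?N)
      = ennreal ((exp (lam * t p) - exp (lam * t (p - 1))) / (lam * t q) *
       ((exp (- lam * t q) - exp (- lam * t (q - 1))) / (- lam * t q)))"
    by simp
  have "exp_A lam t ?C k = enn2real
    (\<integral>\<^sup>+z. (\<Prod>i\<in>?C. g i (fst z i)) \<partial>?N)"
  proof (subst exp_A_eq_nn_integral)
    have "(\<Prod>i\<in>?C. exp_g t ?C i (fst z i)) * ennreal (exp_weight lam t ?C k z) = (\<Prod>i\<in>?C. g i (fst z i))" for z
    proof -
      have "exp_weight lam t ?C k z = exp (lam * t q * fst z p) * exp (- lam * t q * fst z q)"
        unfolding exp_weight_def Mm using k by (simp add: exp_add[symmetric] algebra_simps)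
      then show ?thesis
        using pq by (simp add: g_def ennreal_mult mult_ac)
    qed
    then show "enn2real (\<integral>\<^sup>+ z. (\<Prod>i\<in>?C - exp_C2 ?C k. exp_g t ?C i (fst z i)) *
                     (\<Prod>i\<in>exp_C2 ?C k. exp_h t ?C k i (fst z i) (snd z i)) *
                     ennreal (exp_weight lam t ?C k z) \<partial>exp_measure ?C k) =
      enn2real (\<integral>\<^sup>+z. (\<Prod>i\<in>?C. g i (fst z i)) \<partial>?N)"
      unfolding C2 by simp
  qed (use k in auto)
  also have "\<dots> = (exp (lam * t p) - exp (lam * t (p - 1))) / (lam * t q) *
       ((exp (- lam * t q) - exp (- lam * t (q - 1))) / (- lam * t q))"
    unfolding * using lam t pos
    by (intro enn2real_ennreal mult_nonneg_nonneg divide_nonneg_pos divide_nonpos_neg) auto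
  finally show ?thesis
    using lam pos by (simp add: field_simps power2_eq_square)
qed

subsection \<open>Joint moments of increments\<close>

lemma has_sum_prod_PiE:
  fixes f :: "'i \<Rightarrow> 'b \<Rightarrow> real"
  assumes "finite A" and "\<And>i. i \<in> A \<Longrightarrow> (f i has_sum S i) (B i)"
    and "\<And>i x. i \<in> A \<Longrightarrow> x \<in> B i \<Longrightarrow> f i x \<ge> 0"
  shows "((\<lambda>g. \<Prod>i\<in>A. f i (g i)) has_sum (\<Prod>i\<in>A. S i)) (Pi\<^sub>E A B)"
  using assms
proof (induction A rule: finite_induct)
  case empty
  then show ?case by (simp add: has_sum_finite_iff)
next
  case (insert a A)
  have inj: "inj_on (\<lambda>(y, g). g(a := y)) (B a \<times> Pi\<^sub>E A B)"
    by (rule inj_combinator[OF insert.hyps(2)])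
  have IH: "((\<lambda>g. \<Prod>i\<in>A. f i (g i)) has_sum (\<Prod>i\<in>A. S i)) (Pi\<^sub>E A B)"
    using insert.prems by (intro insert.IH) auto
  have inner: "((\<lambda>g. f a y * (\<Prod>i\<in>A. f i (g i))) has_sum f a y * (\<Prod>i\<in>A. S i)) (Pi\<^sub>E A B)" for y
    by (intro has_sum_cmult_right IH)
  have outer: "((\<lambda>y. f a y * (\<Prod>i\<in>A. S i)) has_sum S a * (\<Prod>i\<in>A. S i)) (B a)"
    by (intro has_sum_cmult_left insert.prems) simp
  \<comment> \<open>For nonnegative terms, summability of the iterated sums already gives joint
    summability; this is where the sign assumption enters.\<close>
  have "(\<lambda>z. f a (fst z) * (\<Prod>i\<in>A. f i (snd z i))) summable_on (B a \<times> Pi\<^sub>E A B)"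
  proof (rule summable_on_SigmaI)
    show "((\<lambda>g. f a (fst (y, g)) * (\<Prod>i\<in>A. f i (snd (y, g) i))) has_sum f a y * (\<Prod>i\<in>A. S i)) (Pi\<^sub>E A B)" for y
      using inner by simp
    show "(\<lambda>y. f a y * (\<Prod>i\<in>A. S i)) summable_on B a"
      using outer by (rule has_sum_imp_summable)
  qed (use insert.prems in \<open>auto intro!: mult_nonneg_nonneg prod_nonneg simp: PiE_iff\<close>)
  then have "((\<lambda>z. f a (fst z) * (\<Prod>i\<in>A. f i (snd z i))) has_sum S a * (\<Prod>i\<in>A. S i)) (B a \<times> Pi\<^sub>E A B)"
    by (intro has_sum_SigmaI[OF _ outer]) (simp_all add: inner)
  also have "(\<lambda>z. f a (fst z) * (\<Prod>i\<in>A. f i (snd z i)))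
      = (\<lambda>g. \<Prod>i\<in>insert a A. f i (g i)) \<circ> (\<lambda>(y, g). g(a := y))"
  proof
    fix z
    have "(\<Prod>i\<in>A. f i (((snd z)(a := fst z)) i)) = (\<Prod>i\<in>A. f i (snd z i))"
      using insert.hyps by (intro prod.cong) auto
    then show "f a (fst z) * (\<Prod>i\<in>A. f i (snd z i))
        = ((\<lambda>g. \<Prod>i\<in>insert a A. f i (g i)) \<circ> (\<lambda>(y, g). g(a := y))) z"
      using insert.hyps by (simp add: case_prod_beta)
  qed
  finally show ?case
    unfolding has_sum_reindex[OF inj, symmetric] PiE_insert_eq using insert.hyps by simp
qed

text \<open>Allows multi-indices on \<open>C\<close> to be extended by zero to all of
  \<open>{1..m}\<close> without changing their integral.\<close>

lemma exp_A_cong: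
  assumes fin: "finite C" "C \<noteq> {}" and k: "\<forall>i\<in>C. k i = k' i"
  shows "exp_A lam t C k = exp_A lam t C k'"
proof -
  have C1: "exp_C1 C k = exp_C1 C k'" and C2: "exp_C2 C k = exp_C2 C k'"
    using k by (auto simp: exp_C1_def exp_C2_def)
  then have "exp_Q t C k = exp_Q t C k'" by (simp add: exp_Q_def)
  moreover have "(\<Prod>i\<in>exp_C2 C k'. (x i - x' i) ^ (k i - 2) / Gamma (real (k i) - 1))
      = (\<Prod>i\<in>exp_C2 C k'. (x i - x' i) ^ (k' i - 2) / Gamma (real (k' i) - 1))" for x x' :: "nat \<Rightarrow> real"
    using k by (intro prod.cong) (auto simp: exp_C2_def)
  moreover have "k (Min C) = k' (Min C)" using k fin by simp
  ultimately show ?thesis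
    unfolding exp_A_def C2 by simp
qed

text \<open>After multiplication by \<open>t (Max C)\<close> the largest variable lies in the last
  interval of \<open>C\<close> and the smallest in the first. If \<open>C\<close> is a singleton
  these intervals coincide, and the upper bound becomes
  \<open>exp (lam * (t i - t (i - 1)))\<close>, which is at least 1 on a nondegenerate grid
  interval.\<close>

lemma exp_weight_bounds:
  assumes fin: "finite C" "C \<noteq> {}" and k: "\<forall>i\<in>C. k i \<ge> 1" and lam: "lam \<ge> 0"
    and pos: "t (Max C) > 0" and z: "z \<in> exp_Q t C k"
  shows "exp (- lam * (t (Max C) - t (Min C - 1))) \<le> exp_weight lam t C k z"
    and "exp_weight lam t C k z \<le> exp (- lam * (t (Max C - 1) - t (Min C)))"
proof -
  define x1 where "x1 = (if k (Min C) \<ge> 2 then snd z (Min C) else fst z (Min C))"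
  have M: "Max C \<in> C" and m: "Min C \<in> C" using fin by auto
  have split: "i \<in> exp_C1 C k \<or> i \<in> exp_C2 C k" if "i \<in> C" for i
    using that k by (force simp: exp_C1_def exp_C2_def)
  have x: "t (i - 1) / t (Max C) < fst z i \<and> fst z i < t i / t (Max C)" if "i \<in> C" for i
    using split[OF that] z by (cases z) (fastforce simp: exp_Q_def Let_def)
  have x': "t (i - 1) / t (Max C) < snd z i \<and> snd z i < t i / t (Max C)" if "i \<in> C" "k i \<ge> 2" for i
    using that z by (cases z) (fastforce simp: exp_Q_def Let_def exp_C2_def)
  have "t (Min C - 1) / t (Max C) < x1 \<and> x1 < t (Min C) / t (Max C)"
    using x[OF m] x'[OF m] by (auto simp: x1_def)
  then have 1: "t (Min C - 1) \<le> t (Max C) * x1" "t (Max C) * x1 \<le> t (Min C)"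
    using pos by (auto simp: field_simps)
  have 2: "t (Max C - 1) \<le> t (Max C) * fst z (Max C)" "t (Max C) * fst z (Max C) \<le> t (Max C)"
    using x[OF M] pos by (auto simp: field_simps)
  have w: "exp_weight lam t C k z = exp (- (lam * (t (Max C) * fst z (Max C) - t (Max C) * x1)))"
    unfolding exp_weight_def x1_def by (simp add: right_diff_distrib mult.assoc)
  show "exp (- lam * (t (Max C) - t (Min C - 1))) \<le> exp_weight lam t C k z"
    and "exp_weight lam t C k z \<le> exp (- lam * (t (Max C - 1) - t (Min C)))"
    unfolding w using 1 2 lam by (auto intro!: mult_left_mono)
qed

lemma power_sum_mult_prod_divide:
  fixes c :: real
  assumes "c > 0"
  shows "c ^ (\<Sum>i\<in>C. k i) * (\<Prod>i\<in>C. (d i / c) ^ k i / fact (k i)) = (\<Prod>i\<in>C. d i ^ k i / fact (k i))"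
  unfolding power_sum prod.distrib[symmetric]
  using assms by (intro prod.cong refl) (simp add: power_divide)

text \<open>The weight has an upper bound \<open>U\<close> that does not depend on \<open>k\<close>,
  so the terms are dominated by \<open>U\<close> times a product of exponential series in
  \<open>\<bar>S i * d i\<bar>\<close>, where \<open>d i\<close> is the length of the
  interval.\<close>

lemma summable_exp_series:
  assumes fin: "finite C" "C \<noteq> {}" and lam: "lam \<ge> 0"
    and t: "\<forall>i\<in>C. t (i - 1) \<le> t i" and pos: "t (Max C) > 0"
  shows "(\<lambda>k. t (Max C) ^ (\<Sum>i\<in>C. k i) * (\<Prod>i\<in>C. S i ^ k i) * exp_A lam t C k) summable_on (\<Pi>\<^sub>E i\<in>C. {1..})"
proof -
  define U where "U = exp (- lam * (t (Max C - 1) - t (Min C)))"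
  define d where "d = (\<lambda>i. t i - t (i - 1))"
  define f where "f = (\<lambda>k. (\<Prod>i\<in>C. \<bar>S i * d i\<bar> ^ k i / fact (k i)) * U)"
  have exp_sum: "((\<lambda>n. \<bar>S i * d i\<bar> ^ n / fact n) has_sum exp \<bar>S i * d i\<bar>) UNIV" for i
    using exp_converges[of "\<bar>S i * d i\<bar>"] by (intro sums_nonneg_imp_has_sum) (auto simp: field_simps)
  have "((\<lambda>k. \<Prod>i\<in>C. \<bar>S i * d i\<bar> ^ k i / fact (k i)) has_sum (\<Prod>i\<in>C. exp \<bar>S i * d i\<bar>)) (\<Pi>\<^sub>E i\<in>C. UNIV)"
    by (intro has_sum_prod_PiE fin exp_sum) auto
  then have "f summable_on (\<Pi>\<^sub>E i\<in>C. UNIV)"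
    unfolding f_def using has_sum_cmult_left has_sum_imp_summable by blast
  then have "f summable_on (\<Pi>\<^sub>E i\<in>C. {1..})"
    by (rule summable_on_subset_banach) auto
  moreover have "norm (f k) = f k" for k
    by (simp add: f_def U_def prod_nonneg)
  ultimately have "(\<lambda>k. norm (f k)) summable_on (\<Pi>\<^sub>E i\<in>C. {1..})" by simp
  then have "(\<lambda>k. norm (t (Max C) ^ (\<Sum>i\<in>C. k i) * (\<Prod>i\<in>C. S i ^ k i) * exp_A lam t C k)) summable_on (\<Pi>\<^sub>E i\<in>C. {1..})"
  proof (rule Infinite_Sum.abs_summable_on_comparison_test)
    fix k :: "nat \<Rightarrow> nat"
    assume "k \<in> (\<Pi>\<^sub>E i\<in>C. {1..})"
    then have k: "\<forall>i\<in>C. k i \<ge> 1" by auto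
    \<comment> \<open>With lower bound 0 the first part of \<open>exp_A_bounds\<close> is just the
      nonnegativity of \<open>exp_A\<close>, which removes the absolute value.\<close>
    have w: "z \<in> exp_Q t C k \<Longrightarrow> 0 \<le> exp_weight lam t C k z \<and> exp_weight lam t C k z \<le> U" for z
      using exp_weight_bounds(2)[where t = t, OF fin k lam pos] by (auto simp: exp_weight_def U_def)
    note A = exp_A_bounds[OF fin k t pos order.refl _ w]
    have "norm (t (Max C) ^ (\<Sum>i\<in>C. k i) * (\<Prod>i\<in>C. S i ^ k i) * exp_A lam t C k)
        = (\<Prod>i\<in>C. \<bar>S i\<bar> ^ k i) * (t (Max C) ^ (\<Sum>i\<in>C. k i) * exp_A lam t C k)"
      using pos A(1) by (simp add: U_def abs_mult abs_prod power_abs)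
    also have "\<dots> \<le> (\<Prod>i\<in>C. \<bar>S i\<bar> ^ k i) * (t (Max C) ^ (\<Sum>i\<in>C. k i) *
        ((\<Prod>i\<in>C. (d i / t (Max C)) ^ k i / fact (k i)) * U))"
      using pos A(2) by (intro mult_left_mono) (auto simp: U_def d_def prod_nonneg)
    also have "\<dots> = (\<Prod>i\<in>C. \<bar>S i\<bar> ^ k i) * (\<Prod>i\<in>C. d i ^ k i / fact (k i)) * U"
      using power_sum_mult_prod_divide[OF pos, of k C d] by (simp add: mult_ac)
    also have "(\<Prod>i\<in>C. \<bar>S i\<bar> ^ k i) * (\<Prod>i\<in>C. d i ^ k i / fact (k i)) = (\<Prod>i\<in>C. \<bar>S i * d i\<bar> ^ k i / fact (k i))"
      unfolding prod.distrib[symmetric] using t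
      by (intro prod.cong refl) (simp add: d_def abs_mult power_mult_distrib)
    also have "\<dots> * U \<le> norm (f k)"
      by (simp add: f_def)
    finally show "norm (t (Max C) ^ (\<Sum>i\<in>C. k i) * (\<Prod>i\<in>C. S i ^ k i) * exp_A lam t C k) \<le> norm (f k)" .
  qed
  then show ?thesis by (rule abs_summable_summable)
qed

text \<open>Merges the sum over \<open>C\<close> and the sum over positive multi-indices on
  \<open>C\<close> into one sum over all multi-indices on \<open>{1..m}\<close>: \<open>C\<close> is
  recovered as the support, and the zero multi-index yields the leading 1.\<close>

definition exp_coeff :: "real \<Rightarrow> real \<Rightarrow> real \<Rightarrow> nat \<Rightarrow> (nat \<Rightarrow> real) \<Rightarrow> (nat \<Rightarrow> nat) \<Rightarrow> real" where
  "exp_coeff lam b T m t k =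
     (let C = {i \<in> {1..m}. k i \<ge> 1} in
      if C = {} then 1 else b * exp (- lam * T) * t (Max C) ^ (\<Sum>i\<in>C. k i) * exp_A lam t C k)"

text \<open>The multi-indices on \<open>{1..m}\<close> are partitioned by their support into
  finitely many classes \<open>B C\<close>, and each class reproduces one summand of
  \<open>exp_mgf\<close>.\<close>

lemma has_sum_exp_mgf:
  assumes lam: "lam \<ge> 0" and t0: "t 0 = 0" and mono: "strict_mono_on {0..m} t"
  shows "((\<lambda>k. exp_coeff lam b T m t k * (\<Prod>i\<in>{1..m}. (\<Sum>j=i..m. s j) ^ k i)) has_sum
           exp_mgf lam b T m t s) (\<Pi>\<^sub>E i\<in>{1..m}. UNIV)"
proof -
  define I where "I = {1..m}"
  define S where "S = (\<lambda>i. \<Sum>j=i..m. s j)"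
  define B where "B = (\<lambda>C. {k \<in> \<Pi>\<^sub>E i\<in>I. UNIV. {i \<in> I. k i \<ge> (1 :: nat)} = C})"
  define v where "v = (\<lambda>C. if C = {} then 1 else b * exp (- lam * T) *
          (\<Sum>\<^sub>\<infinity>k \<in> (\<Pi>\<^sub>E i\<in>C. {1..}).
            t (Max C) ^ (\<Sum>i\<in>C. k i) * (\<Prod>i\<in>C. S i ^ k i) * exp_A lam t C k))"
  have finI: "finite I" by (simp add: I_def)
  have part: "((\<lambda>k. exp_coeff lam b T m t k * (\<Prod>i\<in>I. S i ^ k i)) has_sum v C) (B C)" if C: "C \<in> Pow I" for C
  proof (cases "C = {}")
    case True
    then have "k \<in> B C \<longleftrightarrow> k = (\<lambda>i\<in>I. 0)" for k
      by (auto simp: B_def fun_eq_iff PiE_def extensional_def Suc_le_eq)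
    then have "B C = {\<lambda>i\<in>I. 0}" by blast
    then show ?thesis
      using True by (simp add: has_sum_finite_iff v_def exp_coeff_def I_def)
  next
    case False
    have fin: "finite C" using C finI finite_subset by auto
    \<comment> \<open>Extension by zero on \<open>I - C\<close>, keeping the value
      \<open>undefined\<close> outside \<open>I\<close> that membership in \<open>PiE\<close>
      demands; it inverts the restriction to \<open>C\<close>.\<close>
    define e where "e = (\<lambda>k i. if i \<in> C then k i else if i \<in> I then 0 else (undefined :: nat))"
    have tC: "\<forall>i\<in>C. t (i - 1) \<le> t i"
    proof
      fix i assume "i \<in> C"
      then have "i \<le> m" using C by (auto simp: I_def)
      then show "t (i - 1) \<le> t i"
        by (intro strict_mono_on_leD[OF mono]) auto
    qed
    have "Max C \<in> I" using C Max_in[OF fin False] by auto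
    then have pos: "t (Max C) > 0"
      using strict_mono_onD[OF mono, of 0 "Max C"] t0 by (auto simp: I_def)
    have "((\<lambda>k. t (Max C) ^ (\<Sum>i\<in>C. k i) * (\<Prod>i\<in>C. S i ^ k i) * exp_A lam t C k) has_sum
        (\<Sum>\<^sub>\<infinity>k \<in> (\<Pi>\<^sub>E i\<in>C. {1..}).
            t (Max C) ^ (\<Sum>i\<in>C. k i) * (\<Prod>i\<in>C. S i ^ k i) * exp_A lam t C k)) (\<Pi>\<^sub>E i\<in>C. {1..})"
      by (intro has_sum_infsum summable_exp_series fin False lam tC pos)
    from has_sum_cmult_right[OF this, of "b * exp (- lam * T)"]
    have "((\<lambda>k. b * exp (- lam * T) * (t (Max C) ^ (\<Sum>i\<in>C. k i) * (\<Prod>i\<in>C. S i ^ k i) * exp_A lam t C k))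
        has_sum v C) (\<Pi>\<^sub>E i\<in>C. {1..})"
      using False by (simp add: v_def)
    then show ?thesis
    proof (rule iffD1[OF has_sum_reindex_bij_witness[where j = e and i = "\<lambda>k. restrict k C"], rotated -1])
      fix k :: "nat \<Rightarrow> nat"
      assume k: "k \<in> (\<Pi>\<^sub>E i\<in>C. {1..})"
      then show "restrict (e k) C = k"
        by (auto simp: e_def fun_eq_iff PiE_def extensional_def)
      have supp: "{i \<in> I. e k i \<ge> 1} = C"
        using k C by (auto simp: e_def)
      then show "e k \<in> B C"
        using C by (auto simp: B_def e_def)
      have "(\<Prod>i\<in>I. S i ^ e k i) = (\<Prod>i\<in>C. S i ^ k i)"
        using C finI by (intro prod.mono_neutral_cong_right) (auto simp: e_def)
      moreover have "exp_A lam t C (e k) = exp_A lam t C k"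
        by (rule exp_A_cong[OF fin False]) (simp add: e_def)
      moreover have "(\<Sum>i\<in>C. e k i) = (\<Sum>i\<in>C. k i)"
        by (simp add: e_def)
      ultimately show "exp_coeff lam b T m t (e k) * (\<Prod>i\<in>I. S i ^ e k i)
          = b * exp (- lam * T) * (t (Max C) ^ (\<Sum>i\<in>C. k i) * (\<Prod>i\<in>C. S i ^ k i) * exp_A lam t C k)"
        using False unfolding exp_coeff_def I_def[symmetric] supp Let_def by simp
    next
      fix k assume k: "k \<in> B C"
      then show "e (restrict k C) = k" "restrict k C \<in> (\<Pi>\<^sub>E i\<in>C. {1..})"
        using C by (auto simp: B_def e_def fun_eq_iff PiE_def extensional_def Suc_le_eq)
    qed simp
  qed
  have "((\<lambda>k. exp_coeff lam b T m t k * (\<Prod>i\<in>I. S i ^ k i)) has_sum sum v (Pow I)) (\<Union>C\<in>Pow I. B C)"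
    by (rule sum_has_sum[OF _ part]) (use finI in \<open>auto simp: B_def\<close>)
  moreover have "(\<Union>C\<in>Pow I. B C) = (\<Pi>\<^sub>E i\<in>I. UNIV)"
    by (auto simp: B_def)
  moreover have "sum v (Pow I) = exp_mgf lam b T m t s"
  proof -
    have "sum v (Pow I) = v {} + sum v (Pow I - {{}})"
      using finI by (subst sum.remove[of _ "{}"]) auto
    also have "sum v (Pow I - {{}}) = (\<Sum>C | C \<subseteq> I \<and> C \<noteq> {}. v C)"
      by (rule sum.cong) auto
    finally show ?thesis
      by (simp add: v_def exp_mgf_def I_def S_def sum_distrib_left)
  qed
  ultimately show ?thesis
    by (simp add: I_def S_def)
qed

text \<open>Abel summation, used to rewrite an exponent in the values \<open>X (t j)\<close> as one
  in the increments.\<close>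

lemma sum_mult_diff_by_parts:
  fixes S x :: "nat \<Rightarrow> 'a::comm_ring"
  shows "(\<Sum>j=1..m. (S j - S (Suc j)) * x j) = (\<Sum>i=1..m. S i * (x i - x (i - 1))) + S 1 * x 0 - S (Suc m) * x m"
  by (induction m) (simp_all add: algebra_simps)

lemma strict_mono_on_grid:
  fixes t :: "nat \<Rightarrow> real"
  assumes "t 0 = 0" and "strict_mono_on {0..m} t" and "t m \<le> T" and "i \<le> m"
  shows "t i \<in> {0..T}"
  using assms strict_mono_on_leD[of "{0..m}" t 0 i] strict_mono_on_leD[of "{0..m}" t i m] by auto

section \<open>From the generating function to moments of increments\<close>

context exp_process
begin

lemma increment_moments:
  assumes lam: "lam \<ge> 0" and t0: "t 0 = 0" and mono: "strict_mono_on {0..m} t" and T: "t m \<le> T"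
    and C: "C \<subseteq> {1..m}" "C \<noteq> {}" and k: "\<forall>i\<in>C. k i \<ge> 1"
  shows "integrable M (\<lambda>\<omega>. \<Prod>i\<in>C. (X (t i) \<omega> - X (t (i - 1)) \<omega>) ^ k i)"
    and "expectation (\<lambda>\<omega>. \<Prod>i\<in>C. (X (t i) \<omega> - X (t (i - 1)) \<omega>) ^ k i)
      = b * exp (- lam * T) * t (Max C) ^ (\<Sum>i\<in>C. k i) * exp_A lam t C k * (\<Prod>i\<in>C. fact (k i))"
proof -
  define Y where "Y = (\<lambda>i \<omega>. X (t i) \<omega> - X (t (i - 1)) \<omega>)"
  \<comment> \<open>Exponent 0 off \<open>C\<close> makes the unwanted increments disappear from the
    moment.\<close>
  define K where "K = (\<lambda>i\<in>{1..m}. if i \<in> C then k i else 0)"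
  have fin: "finite C" using C finite_subset by auto
  have rv: "X (t i) \<in> borel_measurable M" if "i \<le> m" for i
    using random_variable_X[OF strict_mono_on_grid[OF t0 mono T that]] .
  have mgf_Y: "integrable M (\<lambda>\<omega>. exp (\<Sum>i\<in>{1..m}. S i * Y i \<omega>)) \<and>
      ((\<lambda>k. exp_coeff lam b T m t k * (\<Prod>i\<in>{1..m}. S i ^ k i)) has_sum
        expectation (\<lambda>\<omega>. exp (\<Sum>i\<in>{1..m}. S i * Y i \<omega>))) (\<Pi>\<^sub>E i\<in>{1..m}. UNIV)" for S
  proof -
    \<comment> \<open>Cutting \<open>S\<close> off beyond \<open>m\<close> makes
      \<open>S' (Suc m) = 0\<close>, so the tail sums of \<open>s\<close> telescope to
      \<open>S i\<close> and the upper boundary term of the summation by parts vanishes. Hence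
      arbitrary values \<open>S i\<close> can be prescribed.\<close>
    define S' where "S' = (\<lambda>i. if i \<le> m then S i else 0)"
    define s where "s = (\<lambda>j. S' j - S' (Suc j))"
    have tail: "(\<Sum>j=i..m. s j) = S i" if "i \<in> {1..m}" for i
    proof -
      have "(\<Sum>j=i..m. s j) = - (\<Sum>j=i..m. S' (Suc j) - S' j)"
        by (simp add: s_def sum_negf[symmetric])
      also have "\<dots> = S i"
        using that by (subst sum_Suc_diff) (auto simp: S'_def)
      finally show ?thesis .
    qed
    \<comment> \<open>The other boundary term contains \<open>X 0\<close>, which is 0 only almost
      everywhere.\<close>
    have "AE \<omega> in M. exp (\<Sum>j=1..m. s j * X (t j) \<omega>) = exp (\<Sum>i\<in>{1..m}. S i * Y i \<omega>)"
      using X_0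
    proof eventually_elim
      case (elim \<omega>)
      have "(\<Sum>j=1..m. s j * X (t j) \<omega>) = (\<Sum>i=1..m. S' i * Y i \<omega>)"
        unfolding s_def Y_def
        using sum_mult_diff_by_parts[of S' "\<lambda>j. X (t j) \<omega>" m] elim t0 by (simp add: S'_def)
      also have "\<dots> = (\<Sum>i\<in>{1..m}. S i * Y i \<omega>)"
        by (intro sum.cong) (auto simp: S'_def)
      finally show ?case by simp
    qed
    moreover have "(\<lambda>\<omega>. exp (\<Sum>j=1..m. s j * X (t j) \<omega>)) \<in> borel_measurable M"
      "(\<lambda>\<omega>. exp (\<Sum>i\<in>{1..m}. S i * Y i \<omega>)) \<in> borel_measurable M"
      unfolding Y_def
      by (auto intro!: measurable_compose[OF _ borel_measurable_exp] borel_measurable_sum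
          borel_measurable_times borel_measurable_diff rv)
    ultimately have int: "integrable M (\<lambda>\<omega>. exp (\<Sum>i\<in>{1..m}. S i * Y i \<omega>))"
      and ex: "expectation (\<lambda>\<omega>. exp (\<Sum>i\<in>{1..m}. S i * Y i \<omega>)) = exp_mgf lam b T m t s"
      using integrable_exp[OF t0 mono T, of s] mgf[OF t0 mono T, of s]
        integrable_cong_AE[of "\<lambda>\<omega>. exp (\<Sum>j=1..m. s j * X (t j) \<omega>)" M "\<lambda>\<omega>. exp (\<Sum>i\<in>{1..m}. S i * Y i \<omega>)"]
        integral_cong_AE[of "\<lambda>\<omega>. exp (\<Sum>j=1..m. s j * X (t j) \<omega>)" M "\<lambda>\<omega>. exp (\<Sum>i\<in>{1..m}. S i * Y i \<omega>)"]
      by auto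
    have pr: "(\<Prod>i\<in>{1..m}. (\<Sum>j=i..m. s j) ^ k i) = (\<Prod>i\<in>{1..m}. S i ^ k i)" for k
      by (intro prod.cong refl) (simp only: tail)
    show ?thesis
      using has_sum_exp_mgf[OF lam t0 mono, of b T s] int unfolding ex pr by (rule conjI[rotated])
  qed
  have mom: "integrable M (\<lambda>\<omega>. 1 * (\<Prod>i\<in>{1..m}. Y i \<omega> ^ K i)) \<and>
      (\<integral>\<omega>. 1 * (\<Prod>i\<in>{1..m}. Y i \<omega> ^ K i) \<partial>M) = exp_coeff lam b T m t K * (\<Prod>i\<in>{1..m}. fact (K i))"
  proof (rule moments_from_mgf)
    show "Y i \<in> borel_measurable M" if "i \<in> {1..m}" for i
      using that unfolding Y_def by (intro borel_measurable_diff rv) auto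
    show "K \<in> (\<Pi>\<^sub>E i\<in>{1..m}. UNIV)" by (auto simp: K_def)
    show "integrable M (\<lambda>\<omega>. 1 * exp (\<Sum>i\<in>{1..m}. S i * Y i \<omega>))"
      and "((\<lambda>k. exp_coeff lam b T m t k * (\<Prod>i\<in>{1..m}. S i ^ k i)) has_sum
        expectation (\<lambda>\<omega>. 1 * exp (\<Sum>i\<in>{1..m}. S i * Y i \<omega>))) (\<Pi>\<^sub>E i\<in>{1..m}. UNIV)" for S
      using mgf_Y[of S] by simp_all
  qed simp_all
  have prod: "(\<Prod>i\<in>{1..m}. Y i \<omega> ^ K i) = (\<Prod>i\<in>C. Y i \<omega> ^ k i)" for \<omega>
    using C by (intro prod.mono_neutral_cong_right) (auto simp: K_def)
  have fact: "(\<Prod>i\<in>{1..m}. fact (K i) :: real) = (\<Prod>i\<in>C. fact (k i))"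
    using C by (intro prod.mono_neutral_cong_right) (auto simp: K_def)
  have supp: "{i \<in> {1..m}. K i \<ge> 1} = C"
    using C k by (auto simp: K_def)
  have "(\<Sum>i\<in>C. K i) = (\<Sum>i\<in>C. k i)"
    using C by (intro sum.cong) (auto simp: K_def)
  moreover have "exp_A lam t C K = exp_A lam t C k"
    using C by (intro exp_A_cong fin) (auto simp: K_def)
  ultimately have coeff: "exp_coeff lam b T m t K = b * exp (- lam * T) * t (Max C) ^ (\<Sum>i\<in>C. k i) * exp_A lam t C k"
    using C supp by (simp add: exp_coeff_def Let_def)
  show "integrable M (\<lambda>\<omega>. \<Prod>i\<in>C. (X (t i) \<omega> - X (t (i - 1)) \<omega>) ^ k i)"
    "expectation (\<lambda>\<omega>. \<Prod>i\<in>C. (X (t i) \<omega> - X (t (i - 1)) \<omega>) ^ k i)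
      = b * exp (- lam * T) * t (Max C) ^ (\<Sum>i\<in>C. k i) * exp_A lam t C k * (\<Prod>i\<in>C. fact (k i))"
    using mom unfolding prod fact coeff by (simp_all add: Y_def)
qed

end

section \<open>Two-sided moment bounds and the grids behind them\<close>

lemma strict_mono_on_atLeast0_SucI:
  fixes g :: "nat \<Rightarrow> 'a::order"
  assumes step: "\<And>i. i < n \<Longrightarrow> g i < g (Suc i)"
  shows "strict_mono_on {0..n} g"
proof (rule strict_mono_onI)
  have "i < j \<Longrightarrow> j \<le> n \<Longrightarrow> g i < g j" for i j
  proof (induction j)
    case (Suc j)
    then show ?case
      using step[of j] by (cases "i = j") (auto intro: less_trans)
  qed simp
  then show "i \<in> {0..n} \<Longrightarrow> j \<in> {0..n} \<Longrightarrow> i < j \<Longrightarrow> g i < g j" for i j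
    by simp
qed

text \<open>Meant for overlapping increments, whose product is not a product over distinct grid
  intervals and so is not covered directly by \<open>increment_moments\<close>.\<close>

lemma integrable_mult_of_squares:
  fixes f g :: "'a \<Rightarrow> real"
  assumes [measurable]: "f \<in> borel_measurable M" "g \<in> borel_measurable M"
    and "integrable M (\<lambda>x. f x ^ 2)" "integrable M (\<lambda>x. g x ^ 2)"
  shows "integrable M (\<lambda>x. f x * g x)"
proof (rule Bochner_Integration.integrable_bound)
  show "integrable M (\<lambda>x. f x ^ 2 + g x ^ 2)"
    using assms by (intro Bochner_Integration.integrable_add)
  show "AE x in M. norm (f x * g x) \<le> norm (f x ^ 2 + g x ^ 2)"
  proof (rule AE_I2)
    fix x
    have "2 * (\<bar>f x\<bar> * \<bar>g x\<bar>) \<le> f x ^ 2 + g x ^ 2"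
      using sum_squares_bound[of "\<bar>f x\<bar>" "\<bar>g x\<bar>"] by (simp add: mult.assoc)
    moreover have "0 \<le> \<bar>f x\<bar> * \<bar>g x\<bar>" by simp
    ultimately show "norm (f x * g x) \<le> norm (f x ^ 2 + g x ^ 2)"
      unfolding real_norm_def abs_mult by linarith
  qed
qed measurable

context exp_process
begin

text \<open>\<open>L\<close> and \<open>U\<close> are kept general so that, besides the bounds of
  \<open>exp_weight_bounds\<close>, the choice \<open>L = U = 1\<close> can be made, which gives the
  mean exactly.\<close>

lemma increment_moment_bounds:
  assumes lam: "lam \<ge> 0" and b: "b \<ge> 0"
    and t0: "t 0 = 0" and mono: "strict_mono_on {0..m} t" and T: "t m \<le> T"
    and C: "C \<subseteq> {1..m}" "C \<noteq> {}" and k: "\<forall>i\<in>C. k i \<ge> 1" and LU: "0 \<le> L" "0 \<le> U"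
    and weight: "\<And>z. z \<in> exp_Q t C k \<Longrightarrow> L \<le> exp_weight lam t C k z \<and> exp_weight lam t C k z \<le> U"
  shows "b * exp (- lam * T) * L * (\<Prod>i\<in>C. (t i - t (i - 1)) ^ k i)
      \<le> expectation (\<lambda>\<omega>. \<Prod>i\<in>C. (X (t i) \<omega> - X (t (i - 1)) \<omega>) ^ k i)"
    and "expectation (\<lambda>\<omega>. \<Prod>i\<in>C. (X (t i) \<omega> - X (t (i - 1)) \<omega>) ^ k i)
      \<le> b * exp (- lam * T) * U * (\<Prod>i\<in>C. (t i - t (i - 1)) ^ k i)"
proof -
  have fin: "finite C" using C finite_subset by auto
  have tC: "\<forall>i\<in>C. t (i - 1) \<le> t i"
  proof
    fix i assume "i \<in> C"
    then have "i \<le> m" using C by auto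
    then show "t (i - 1) \<le> t i"
      by (intro strict_mono_on_leD[OF mono]) auto
  qed
  have M: "Max C \<in> C" using fin C by simp
  then have pos: "t (Max C) > 0"
    using strict_mono_onD[OF mono, of 0 "Max C"] t0 C by auto
  define V where "V = (\<Prod>i\<in>C. ((t i - t (i - 1)) / t (Max C)) ^ k i / fact (k i))"
  define F where "F = b * exp (- lam * T) * (t (Max C) ^ (\<Sum>i\<in>C. k i) * (\<Prod>i\<in>C. fact (k i)))"
  have F: "F \<ge> 0" using b pos by (simp add: F_def prod_nonneg)
  have E: "expectation (\<lambda>\<omega>. \<Prod>i\<in>C. (X (t i) \<omega> - X (t (i - 1)) \<omega>) ^ k i) = F * exp_A lam t C k"
    unfolding increment_moments(2)[OF lam t0 mono T C k] F_def by (simp add: mult_ac)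
  have "t (Max C) ^ (\<Sum>i\<in>C. k i) * V * (\<Prod>i\<in>C. fact (k i)) = (\<Prod>i\<in>C. (t i - t (i - 1)) ^ k i)"
    unfolding V_def power_sum_mult_prod_divide[OF pos] prod.distrib[symmetric] by simp
  then have FV: "F * (V * c) = b * exp (- lam * T) * c * (\<Prod>i\<in>C. (t i - t (i - 1)) ^ k i)" for c
    unfolding F_def by (simp add: mult_ac)
  note A = exp_A_bounds[OF fin C(2) k tC pos LU weight]
  show "b * exp (- lam * T) * L * (\<Prod>i\<in>C. (t i - t (i - 1)) ^ k i)
      \<le> expectation (\<lambda>\<omega>. \<Prod>i\<in>C. (X (t i) \<omega> - X (t (i - 1)) \<omega>) ^ k i)"
    "expectation (\<lambda>\<omega>. \<Prod>i\<in>C. (X (t i) \<omega> - X (t (i - 1)) \<omega>) ^ k i)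
      \<le> b * exp (- lam * T) * U * (\<Prod>i\<in>C. (t i - t (i - 1)) ^ k i)"
    unfolding E FV[symmetric] using A F by (auto simp: V_def intro!: mult_left_mono)
qed

lemma
  assumes lam: "lam \<ge> 0" and b: "b \<ge> 0" and uv: "0 \<le> u" "u < v" "v \<le> T" and n: "n \<ge> 1"
  shows integrable_increment_power: "integrable M (\<lambda>\<omega>. (X v \<omega> - X u \<omega>) ^ n)"
    and increment_power_ge: "b * exp (- lam * T) * exp (- lam * (v - u)) * (v - u) ^ n
        \<le> expectation (\<lambda>\<omega>. (X v \<omega> - X u \<omega>) ^ n)"
    and increment_power_le: "expectation (\<lambda>\<omega>. (X v \<omega> - X u \<omega>) ^ n)
        \<le> b * exp (- lam * T) * exp (lam * (v - u)) * (v - u) ^ n"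
    and increment_mean: "expectation (\<lambda>\<omega>. X v \<omega> - X u \<omega>) = b * exp (- lam * T) * (v - u)"
proof -
  \<comment> \<open>A grid must increase strictly from 0, so it is \<open>0, v\<close> or
    \<open>0, u, v\<close> according to whether \<open>u = 0\<close>.\<close>
  obtain m t p where t: "t 0 = 0" "strict_mono_on {0..m::nat} t" "t m \<le> T" and p: "p \<in> {1..m}"
    and tp: "t p = v" "t (p - 1) = u"
  proof (cases "u = 0")
    case True
    show thesis
    proof (rule that[of "(!) [0, v]" 1 1])
      show "strict_mono_on {0..1} ((!) [0, v])"
        by (rule strict_mono_on_atLeast0_SucI) (use uv True in auto)
    qed (use uv True in auto)
  next
    case False
    show thesis
    proof (rule that[of "(!) [0, u, v]" 2 2])
      show "strict_mono_on {0..2} ((!) [0, u, v])"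
        by (rule strict_mono_on_atLeast0_SucI) (use uv False in \<open>auto simp: less_Suc_eq numeral_2_eq_2\<close>)
    qed (use uv False in auto)
  qed
  have C: "{p} \<subseteq> {1..m}" "{p} \<noteq> {}" using p by auto
  have pos: "t (Max {p}) > 0" using tp uv by simp
  have k: "\<forall>i\<in>{p}. (\<lambda>_. n) i \<ge> 1" "\<forall>i\<in>{p}. (\<lambda>_. 1 :: nat) i \<ge> 1" using n by auto
  have w: "exp (- lam * (v - u)) \<le> exp_weight lam t {p} (\<lambda>_. n) z \<and> exp_weight lam t {p} (\<lambda>_. n) z \<le> exp (lam * (v - u))"
    if "z \<in> exp_Q t {p} (\<lambda>_. n)" for z
    using exp_weight_bounds[where t = t, OF _ C(2) k(1) lam pos that] tp by (simp add: algebra_simps)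
  \<comment> \<open>One interval with exponent 1 has a single variable, which is both the smallest
    and the largest.\<close>
  have w1: "1 \<le> exp_weight lam t {p} (\<lambda>_. 1) z \<and> exp_weight lam t {p} (\<lambda>_. 1) z \<le> 1" for z
    by (simp add: exp_weight_def)
  show "integrable M (\<lambda>\<omega>. (X v \<omega> - X u \<omega>) ^ n)"
    using increment_moments(1)[OF lam t C k(1)] tp by simp
  show "b * exp (- lam * T) * exp (- lam * (v - u)) * (v - u) ^ n
        \<le> expectation (\<lambda>\<omega>. (X v \<omega> - X u \<omega>) ^ n)"
    and "expectation (\<lambda>\<omega>. (X v \<omega> - X u \<omega>) ^ n)
        \<le> b * exp (- lam * T) * exp (lam * (v - u)) * (v - u) ^ n"
    using increment_moment_bounds[OF lam b t C k(1) _ _ w] tp by simp_all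
  show "expectation (\<lambda>\<omega>. X v \<omega> - X u \<omega>) = b * exp (- lam * T) * (v - u)"
    using increment_moment_bounds[OF lam b t C k(2) _ _ w1] tp by simp
qed

lemma expectation_increment_mult:
  assumes lam: "lam > 0" and uv: "0 \<le> u" "u < v" "v < u'" "u' < v'" "v' \<le> T"
  shows "expectation (\<lambda>\<omega>. (X v \<omega> - X u \<omega>) * (X v' \<omega> - X u' \<omega>))
    = b * exp (- lam * T) * ((exp (lam * v) - exp (lam * u)) * (exp (- lam * u') - exp (- lam * v')) / lam\<^sup>2)"
proof -
  \<comment> \<open>The gap from \<open>v\<close> to \<open>u'\<close> is a grid interval of its
    own, which \<open>{p, q}\<close> skips; this uses \<open>v < u'\<close>.\<close>
  obtain m t p q where t: "t 0 = 0" "strict_mono_on {0..m::nat} t" "t m \<le> T" and p: "p \<in> {1..m}" "q \<in> {1..m}" "p < q"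
    and tp: "t p = v" "t (p - 1) = u" "t q = v'" "t (q - 1) = u'"
  proof (cases "u = 0")
    case True
    show thesis
    proof (rule that[of "(!) [0, v, u', v']" 3 1 3])
      show "strict_mono_on {0..3} ((!) [0, v, u', v'])"
        by (rule strict_mono_on_atLeast0_SucI) (use uv True in \<open>auto simp: less_Suc_eq numeral_eq_Suc\<close>)
    qed (use uv True in auto)
  next
    case False
    show thesis
    proof (rule that[of "(!) [0, u, v, u', v']" 4 2 4])
      show "strict_mono_on {0..4} ((!) [0, u, v, u', v'])"
        by (rule strict_mono_on_atLeast0_SucI) (use uv False in \<open>auto simp: less_Suc_eq numeral_eq_Suc\<close>)
    qed (use uv False in auto)
  qed
  have C: "{p, q} \<subseteq> {1..m}" "{p, q} \<noteq> {}" using p by auto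
  have k: "\<forall>i\<in>{p, q}. (\<lambda>_. 1 :: nat) i \<ge> 1" by auto
  have "Max {p, q} = q" using p by simp
  then have E: "expectation (\<lambda>\<omega>. (X v \<omega> - X u \<omega>) * (X v' \<omega> - X u' \<omega>))
      = b * exp (- lam * T) * (v'\<^sup>2 * exp_A lam t {p, q} (\<lambda>_. 1))"
    using increment_moments(2)[OF less_imp_le[OF lam] t C k] p tp
    by (simp add: power2_eq_square mult_ac)
  show ?thesis
    unfolding E using exp_A_pair[OF p(3), of "\<lambda>_. 1" lam t] lam tp uv by simp
qed

lemma
  assumes lam: "lam \<ge> 0" and b: "b \<ge> 0" and m: "1 \<le> m" and t: "strict_mono_on {1..m} t" "t m \<le> T"
    and d: "0 < d" "d < t 1" "\<And>i. i \<in> {1..<m} \<Longrightarrow> d < t (Suc i) - t i"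
    and k: "\<forall>i\<in>{1..m}. 1 \<le> k i"
  shows nabla_moment_ge: "b * exp (- lam * T) * exp (- lam * (t m - t 1 + d)) * d ^ (\<Sum>i=1..m. k i)
      \<le> expectation (\<lambda>\<omega>. \<Prod>i=1..m. nabla X d (t i) \<omega> ^ k i)"
    and nabla_moment_le: "expectation (\<lambda>\<omega>. \<Prod>i=1..m. nabla X d (t i) \<omega> ^ k i)
      \<le> b * exp (- lam * T) * exp (- lam * (t m - t 1 - d)) * d ^ (\<Sum>i=1..m. k i)"
proof -
  \<comment> \<open>the grid \<open>0 < t 1 - d < t 1 < t 2 - d < t 2 < \<dots>\<close>\<close>
  define g where "g = (\<lambda>i. if i = 0 then 0 else if even i then t (i div 2) else t (Suc i div 2) - d)"
  \<comment> \<open>The even indices are those of the intervals from \<open>t i - d\<close> to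
    \<open>t i\<close>; the odd ones belong to the gaps.\<close>
  define C where "C = (\<lambda>i. 2 * i) ` {1..m}"
  have g0: "g 0 = 0" by (simp add: g_def)
  have g_even: "g (2 * i) = t i" if "i \<ge> 1" for i using that by (simp add: g_def)
  have g_odd: "g (2 * i - 1) = t i - d" if "i \<ge> 1" for i
  proof -
    have "2 * i - 1 \<noteq> 0" "odd (2 * i - 1)" "Suc (2 * i - 1) div 2 = i" using that by auto
    then show ?thesis by (simp add: g_def)
  qed
  have mono: "strict_mono_on {0..2 * m} g"
  proof (rule strict_mono_on_atLeast0_SucI)
    fix i assume i: "i < 2 * m"
    consider "i = 0" | j where "j \<ge> 1" "i = 2 * j" | j where "j \<ge> 1" "i = 2 * j - 1"
    proof (cases "even i")
      case True
      then show thesis using that(1) that(2)[of "i div 2"] by (cases "i = 0") auto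
    next
      case False
      then show thesis using that(3)[of "Suc i div 2"] by (cases i) auto
    qed
    then show "g i < g (Suc i)"
    proof cases
      case 1
      then show ?thesis using g_odd[of 1] d by (simp add: g0)
    next
      case 2
      then have "g (Suc i) = t (Suc j) - d" using g_odd[of "Suc j"] by simp
      moreover have "j \<in> {1..<m}" using i 2 by auto
      ultimately show ?thesis using d(3)[of j] g_even[of j] 2 by simp
    next
      case 3
      then have "Suc i = 2 * j" by auto
      then show ?thesis using g_odd[of j] g_even[of j] 3 d by simp
    qed
  qed
  have C: "C \<subseteq> {1..2 * m}" "C \<noteq> {}" using m by (auto simp: C_def)
  have fin: "finite C" by (simp add: C_def)
  have inj: "inj_on (\<lambda>i. 2 * i) {1..m::nat}" by (rule inj_onI) simp
  define K where "K = (\<lambda>i. k (i div 2))"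
  have K: "\<forall>i\<in>C. K i \<ge> 1" using k by (auto simp: C_def K_def)
  have Max: "Max C = 2 * m"
    using m fin by (intro Max_eqI) (auto simp: C_def)
  have Min: "Min C = 2"
    using m fin by (intro Min_eqI) (auto simp: C_def intro!: image_eqI[of _ _ 1])
  have T: "g (2 * m) \<le> T" using g_even[OF m] t by simp
  have pos: "g (Max C) > 0"
    using strict_mono_onD[OF mono, of 0 "2 * m"] m by (simp add: Max g0)
  have prod: "(\<Prod>i\<in>C. (X (g i) \<omega> - X (g (i - 1)) \<omega>) ^ K i) = (\<Prod>i=1..m. nabla X d (t i) \<omega> ^ k i)" for \<omega>
    unfolding C_def prod.reindex[OF inj] o_def
    by (intro prod.cong refl) (simp add: g_even g_odd nabla_def K_def del: One_nat_def)
  have prod_d: "(\<Prod>i\<in>C. (g i - g (i - 1)) ^ K i) = d ^ (\<Sum>i=1..m. k i)"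
    unfolding C_def prod.reindex[OF inj] o_def power_sum
    by (intro prod.cong refl) (simp add: g_even g_odd K_def del: One_nat_def)
  have ends: "g (2 * m) = t m" "g (2 * m - 1) = t m - d" "g 2 = t 1" "g (2 - 1) = t 1 - d"
    using g_even[OF m] g_odd[OF m] g_even[of 1] g_odd[of 1] by simp_all
  have w: "exp (- lam * (t m - t 1 + d)) \<le> exp_weight lam g C K z \<and> exp_weight lam g C K z \<le> exp (- lam * (t m - t 1 - d))"
    if "z \<in> exp_Q g C K" for z
    using exp_weight_bounds[where t = g, OF fin C(2) K lam pos that]
    unfolding Max Min ends by (simp add: algebra_simps)
  show "b * exp (- lam * T) * exp (- lam * (t m - t 1 + d)) * d ^ (\<Sum>i=1..m. k i)
      \<le> expectation (\<lambda>\<omega>. \<Prod>i=1..m. nabla X d (t i) \<omega> ^ k i)"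
    and "expectation (\<lambda>\<omega>. \<Prod>i=1..m. nabla X d (t i) \<omega> ^ k i)
      \<le> b * exp (- lam * T) * exp (- lam * (t m - t 1 - d)) * d ^ (\<Sum>i=1..m. k i)"
    using increment_moment_bounds[OF lam b g0 mono T C K _ _ w] unfolding prod prod_d by simp_all
qed

end

subsection \<open>Increments of fixed length\<close>

lemma (in prob_space) cov_eq:
  assumes "integrable M U" "integrable M V" "integrable M (\<lambda>\<omega>. U \<omega> * V \<omega>)"
  shows "cov M U V = expectation (\<lambda>\<omega>. U \<omega> * V \<omega>) - expectation U * expectation V"
proof -
  have "(U \<omega> - expectation U) * (V \<omega> - expectation V)
      = U \<omega> * V \<omega> - expectation V * U \<omega> - expectation U * V \<omega> + expectation U * expectation V" for \<omega>
    by (simp add: algebra_simps)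
  then show ?thesis
    unfolding cov_def using assms by (simp add: prob_space)
qed

context exp_process
begin

lemma nabla_measurable:
  assumes "0 \<le> d" "d \<le> t" "t \<le> T"
  shows "random_variable borel (nabla X d t)"
  unfolding nabla_def[abs_def] using assms by (intro borel_measurable_diff random_variable_X) auto

lemma
  assumes "lam \<ge> 0" "b \<ge> 0" "0 < d" "d \<le> t" "t \<le> T"
  shows integrable_nabla: "integrable M (nabla X d t)"
    and integrable_nabla_square: "integrable M (\<lambda>\<omega>. (nabla X d t \<omega>)\<^sup>2)"
    and nabla_mean: "expectation (nabla X d t) = b * exp (- lam * T) * d"
    and nabla_square_ge: "b * exp (- lam * T) * exp (- lam * d) * d\<^sup>2 \<le> expectation (\<lambda>\<omega>. (nabla X d t \<omega>)\<^sup>2)"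
  using integrable_increment_power[of "t - d" t 1] integrable_increment_power[of "t - d" t 2]
    increment_mean[of "t - d" t 1] increment_power_ge[of "t - d" t 2] assms
  unfolding nabla_def[abs_def] by simp_all

lemma integrable_nabla_mult:
  assumes "lam \<ge> 0" "b \<ge> 0" "0 < d" "d \<le> t" "t \<le> T" "d \<le> s" "s \<le> T"
  shows "integrable M (\<lambda>\<omega>. nabla X d t \<omega> * nabla X d s \<omega>)"
  using assms by (intro integrable_mult_of_squares nabla_measurable integrable_nabla_square) auto

lemma variance_nabla:
  assumes "lam \<ge> 0" "b \<ge> 0" "0 < d" "d \<le> t" "t \<le> T"
  shows "variance (nabla X d t) = expectation (\<lambda>\<omega>. (nabla X d t \<omega>)\<^sup>2) - (b * exp (- lam * T) * d)\<^sup>2"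
  using variance_eq[OF integrable_nabla integrable_nabla_square] nabla_mean assms by simp

lemma cov_nabla:
  assumes "lam \<ge> 0" "b \<ge> 0" "0 < d" "d \<le> t" "t \<le> T" "d \<le> s" "s \<le> T"
  shows "cov M (nabla X d t) (nabla X d s)
    = expectation (\<lambda>\<omega>. nabla X d t \<omega> * nabla X d s \<omega>) - (b * exp (- lam * T) * d)\<^sup>2"
  using cov_eq[OF integrable_nabla integrable_nabla integrable_nabla_mult] nabla_mean assms
  by (simp add: power2_eq_square)

text \<open>Stationarity with shift \<open>h = t - d\<close>, read off at the coordinate
  \<open>d\<close>: there the shifted process is \<open>X t - X (t - d)\<close> and the unshifted
  one \<open>X d - X 0\<close>.\<close>

lemma nabla_square_stationary:
  assumes "0 \<le> d" "d \<le> t" "t \<le> T"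
  shows "expectation (\<lambda>\<omega>. (nabla X d t \<omega>)\<^sup>2) = expectation (\<lambda>\<omega>. (nabla X d d \<omega>)\<^sup>2)"
proof -
  define h where "h = t - d"
  have h: "h \<in> {0..T}" and d: "d \<in> {0..T - h}" using assms by (auto simp: h_def)
  let ?N = "\<Pi>\<^sub>M u\<in>{0..T-h}. (borel :: real measure)"
  define F where "F = (\<lambda>\<omega>. \<lambda>u\<in>{0..T-h}. X (u + h) \<omega> - X h \<omega>)"
  define G where "G = (\<lambda>\<omega>. \<lambda>u\<in>{0..T-h}. X u \<omega> - X 0 \<omega>)"
  have [measurable]: "F \<in> M \<rightarrow>\<^sub>M ?N" "G \<in> M \<rightarrow>\<^sub>M ?N"
    unfolding F_def G_def using h
    by (auto intro!: measurable_restrict borel_measurable_diff random_variable_X)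
  have eval[measurable]: "(\<lambda>w. (w d)\<^sup>2) \<in> borel_measurable ?N"
    using measurable_component_singleton[OF d, of "\<lambda>_. borel :: real measure"] by measurable
  have "expectation (\<lambda>\<omega>. (F \<omega> d)\<^sup>2) = (\<integral>w. (w d)\<^sup>2 \<partial>distr M ?N F)"
    by (rule integral_distr[symmetric]) measurable
  also have "distr M ?N F = distr M ?N G"
    unfolding F_def G_def by (rule stationary_increments[OF h])
  also have "(\<integral>w. (w d)\<^sup>2 \<partial>distr M ?N G) = expectation (\<lambda>\<omega>. (G \<omega> d)\<^sup>2)"
    by (rule integral_distr) measurable
  finally show ?thesis
    using d by (simp add: F_def G_def nabla_def h_def)
qed

lemma variance_nabla_stationary:
  assumes "lam \<ge> 0" "b \<ge> 0" "0 < d" "d \<le> t" "t \<le> T"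
  shows "variance (nabla X d t) = variance (nabla X d d)"
  using assms nabla_square_stationary[of d t] by (simp add: variance_nabla)

text \<open>The second moment is at least \<open>a * exp (- lam * d) * d\<^sup>2\<close>, the
  squared mean is \<open>a * a * d\<^sup>2\<close>, and
  \<open>a \<le> exp (- lam * T) < exp (- lam * d)\<close>.\<close>

lemma variance_nabla_pos:
  assumes "lam > 0" "0 < b" "b \<le> 1" "0 < d" "d \<le> t" "t \<le> T" "d < T"
  shows "variance (nabla X d t) > 0"
proof -
  define a where "a = b * exp (- lam * T)"
  have "a \<le> exp (- lam * T)" using assms by (simp add: a_def)
  also have "\<dots> < exp (- lam * d)" using assms by simp
  finally have "a * d\<^sup>2 * a < a * d\<^sup>2 * exp (- lam * d)"
    using assms by (intro mult_strict_left_mono) (auto simp: a_def)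
  also have "\<dots> \<le> expectation (\<lambda>\<omega>. (nabla X d t \<omega>)\<^sup>2)"
    using nabla_square_ge[of d t] assms by (simp add: a_def mult_ac)
  finally have "(a * d)\<^sup>2 < expectation (\<lambda>\<omega>. (nabla X d t \<omega>)\<^sup>2)"
    by (simp add: power2_eq_square mult_ac)
  moreover have "variance (nabla X d t) = expectation (\<lambda>\<omega>. (nabla X d t \<omega>)\<^sup>2) - (a * d)\<^sup>2"
    unfolding a_def using assms by (intro variance_nabla) auto
  ultimately show ?thesis by linarith
qed

text \<open>
  Since \<open>nabla X d s - nabla X d t = (X s - X t) - (X (s - d) - X (t - d))\<close>, the second moment of this
  difference is of order \<open>(s - t)\<^sup>2\<close>; by stationarity it is twice the variance minus twice the covariance.
\<close>

lemma corr_nabla_overlapping: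
  assumes lam: "lam > 0" and b: "0 < b" "b \<le> 1" and d: "0 < d" "d \<le> t" and s: "t < s" "s \<le> T" "s - t < d"
  shows "\<bar>corr M (nabla X d t) (nabla X d s) - 1\<bar>
    \<le> 2 * b * exp (- lam * T) * exp (lam * d) / variance (nabla X d d) * (s - t)\<^sup>2"
proof -
  define v where "v = variance (nabla X d d)"
  define a where "a = b * exp (- lam * T)"
  define P where "P = (\<lambda>\<omega>. X s \<omega> - X t \<omega>)"
  define Q where "Q = (\<lambda>\<omega>. X (s - d) \<omega> - X (t - d) \<omega>)"
  have v: "v > 0" unfolding v_def using assms by (intro variance_nabla_pos) auto
  have vt: "variance (nabla X d t) = v" and vs: "variance (nabla X d s) = v"
    unfolding v_def using assms by (auto intro!: variance_nabla_stationary)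
  have iP: "integrable M (\<lambda>\<omega>. (P \<omega>)\<^sup>2)" and iQ: "integrable M (\<lambda>\<omega>. (Q \<omega>)\<^sup>2)"
    unfolding P_def Q_def using assms by (auto intro!: integrable_increment_power)
  have int: "integrable M (\<lambda>\<omega>. (nabla X d t \<omega>)\<^sup>2)" "integrable M (\<lambda>\<omega>. (nabla X d s \<omega>)\<^sup>2)"
      "integrable M (\<lambda>\<omega>. nabla X d t \<omega> * nabla X d s \<omega>)"
    using assms by (auto intro!: integrable_nabla_square integrable_nabla_mult)
  have diff: "nabla X d s \<omega> - nabla X d t \<omega> = P \<omega> - Q \<omega>" for \<omega>
    by (simp add: nabla_def P_def Q_def)
  have sq: "(P \<omega> - Q \<omega>)\<^sup>2 = (nabla X d t \<omega>)\<^sup>2 + (nabla X d s \<omega>)\<^sup>2 - 2 * (nabla X d t \<omega> * nabla X d s \<omega>)" for \<omega>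
    unfolding diff[symmetric] by (simp add: power2_eq_square algebra_simps)
  have "expectation (\<lambda>\<omega>. (P \<omega> - Q \<omega>)\<^sup>2) = 2 * v - 2 * cov M (nabla X d t) (nabla X d s)"
    unfolding sq using int vt vs assms by (simp add: variance_nabla cov_nabla)
  moreover have "0 \<le> expectation (\<lambda>\<omega>. (P \<omega> - Q \<omega>)\<^sup>2)" by simp
  moreover have "expectation (\<lambda>\<omega>. (P \<omega> - Q \<omega>)\<^sup>2) \<le> expectation (\<lambda>\<omega>. 2 * (P \<omega>)\<^sup>2 + 2 * (Q \<omega>)\<^sup>2)"
  proof (rule integral_mono)
    show "integrable M (\<lambda>\<omega>. (P \<omega> - Q \<omega>)\<^sup>2)"
      unfolding sq using int by simp
    show "integrable M (\<lambda>\<omega>. 2 * (P \<omega>)\<^sup>2 + 2 * (Q \<omega>)\<^sup>2)"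
      using iP iQ by simp
    show "(P \<omega> - Q \<omega>)\<^sup>2 \<le> 2 * (P \<omega>)\<^sup>2 + 2 * (Q \<omega>)\<^sup>2" for \<omega>
      using zero_le_power2[of "P \<omega> + Q \<omega>"] by (simp add: power2_eq_square algebra_simps)
  qed
  moreover have "expectation (\<lambda>\<omega>. 2 * (P \<omega>)\<^sup>2 + 2 * (Q \<omega>)\<^sup>2)
      \<le> 2 * (a * exp (lam * d) * (s - t)\<^sup>2) + 2 * (a * exp (lam * d) * (s - t)\<^sup>2)"
  proof -
    \<comment> \<open>Replacing \<open>s - t\<close> by \<open>d\<close> in the exponent gives a
      constant that is the same for all admissible pairs.\<close>
    have mono: "a * exp (lam * (s - t)) * (s - t)\<^sup>2 \<le> a * exp (lam * d) * (s - t)\<^sup>2"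
      using assms by (intro mult_right_mono mult_left_mono) (auto simp: a_def)
    have "expectation (\<lambda>\<omega>. (P \<omega>)\<^sup>2) \<le> a * exp (lam * (s - t)) * (s - t)\<^sup>2"
      using increment_power_le[of t s 2] assms by (simp add: P_def a_def)
    moreover have "expectation (\<lambda>\<omega>. (Q \<omega>)\<^sup>2) \<le> a * exp (lam * (s - t)) * (s - t)\<^sup>2"
      using increment_power_le[of "t - d" "s - d" 2] assms by (simp add: Q_def a_def)
    ultimately have "2 * expectation (\<lambda>\<omega>. (P \<omega>)\<^sup>2) + 2 * expectation (\<lambda>\<omega>. (Q \<omega>)\<^sup>2)
      \<le> 2 * (a * exp (lam * d) * (s - t)\<^sup>2) + 2 * (a * exp (lam * d) * (s - t)\<^sup>2)"
      using mono by linarith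
    then show ?thesis
      using iP iQ by simp
  qed
  ultimately have "\<bar>cov M (nabla X d t) (nabla X d s) - v\<bar> \<le> 2 * a * exp (lam * d) * (s - t)\<^sup>2"
    by linarith
  moreover have "corr M (nabla X d t) (nabla X d s) - 1 = (cov M (nabla X d t) (nabla X d s) - v) / v"
    unfolding corr_def vt vs using v by (simp add: diff_divide_distrib)
  ultimately have "\<bar>corr M (nabla X d t) (nabla X d s) - 1\<bar> \<le> 2 * a * exp (lam * d) * (s - t)\<^sup>2 / v"
    using v by (simp add: abs_divide divide_right_mono)
  then show ?thesis
    by (simp add: v_def a_def)
qed

section \<open>Limits as the lag \<open>d\<close> shrinks\<close>

lemma tendsto_nabla_moment:
  fixes m :: nat
  assumes lam: "lam > 0" and b: "0 < b" and m: "1 \<le> m" and t: "0 < t 1" "strict_mono_on {1..m} t" "t m \<le> T"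
    and k: "\<forall>i\<in>{1..m}. 1 \<le> k i"
  shows "((\<lambda>d. expectation (\<lambda>\<omega>. \<Prod>i=1..m. nabla X d (t i) \<omega> ^ k i) / d ^ (\<Sum>i=1..m. k i))
    \<longlongrightarrow> b * exp (- lam * T) * exp (- lam * (t m - t 1))) (at_right 0)"
proof (rule tendsto_sandwich)
  have gap: "0 < t (Suc i) - t i" if "i \<in> {1..<m}" for i
    using strict_mono_onD[OF t(2), of i "Suc i"] that by auto
  have ev: "eventually (\<lambda>d. d < c) (at_right 0)" if "0 < c" for c :: real
    using that eventually_at_right_field by blast
  \<comment> \<open>For such \<open>d\<close> the intervals from \<open>t i - d\<close> to
    \<open>t i\<close> are separated and lie to the right of 0, as the moment bounds
    require.\<close>
  have small: "eventually (\<lambda>d. 0 < d \<and> d < t 1 \<and> (\<forall>i\<in>{1..<m}. d < t (Suc i) - t i)) (at_right 0)"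
    using t(1) by (intro eventually_conj eventually_at_right_less ev eventually_ball_finite ballI gap) auto
  show "eventually (\<lambda>d. b * exp (- lam * T) * exp (- lam * (t m - t 1 + d))
      \<le> expectation (\<lambda>\<omega>. \<Prod>i=1..m. nabla X d (t i) \<omega> ^ k i) / d ^ (\<Sum>i=1..m. k i)) (at_right 0)"
    using small
  proof eventually_elim
    case (elim d)
    then show ?case
      using nabla_moment_ge[OF _ _ m t(2,3) _ _ _ k, of d] lam b by (simp add: pos_le_divide_eq)
  qed
  show "eventually (\<lambda>d. expectation (\<lambda>\<omega>. \<Prod>i=1..m. nabla X d (t i) \<omega> ^ k i) / d ^ (\<Sum>i=1..m. k i)
      \<le> b * exp (- lam * T) * exp (- lam * (t m - t 1 - d))) (at_right 0)"
    using small
  proof eventually_elim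
    case (elim d)
    then show ?case
      using nabla_moment_le[OF _ _ m t(2,3) _ _ _ k, of d] lam b by (simp add: pos_divide_le_eq)
  qed
  show "((\<lambda>d. b * exp (- lam * T) * exp (- lam * (t m - t 1 + d)))
    \<longlongrightarrow> b * exp (- lam * T) * exp (- lam * (t m - t 1))) (at_right 0)"
    by (rule tendsto_eq_intros refl | simp)+
  show "((\<lambda>d. b * exp (- lam * T) * exp (- lam * (t m - t 1 - d)))
    \<longlongrightarrow> b * exp (- lam * T) * exp (- lam * (t m - t 1))) (at_right 0)"
    by (rule tendsto_eq_intros refl | simp)+
qed

lemma tendsto_nabla_moment_single:
  assumes "lam > 0" "0 < b" "0 < t" "t \<le> T" "1 \<le> k"
  shows "((\<lambda>d. expectation (\<lambda>\<omega>. nabla X d t \<omega> ^ k) / d ^ k) \<longlongrightarrow> b * exp (- lam * T)) (at_right 0)"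
  using tendsto_nabla_moment[of 1 "\<lambda>_. t" "\<lambda>_. k"] assms by (simp add: strict_mono_on_def)

lemma tendsto_nabla_mult:
  assumes "lam > 0" "0 < b" "0 < t" "t < s" "s \<le> T"
  shows "((\<lambda>d. expectation (\<lambda>\<omega>. nabla X d t \<omega> * nabla X d s \<omega>) / d\<^sup>2)
    \<longlongrightarrow> b * exp (- lam * T) * exp (- lam * (s - t))) (at_right 0)"
proof -
  have "strict_mono_on {1..2::nat} (\<lambda>i. if i = 1 then t else s)"
    using assms by (auto simp: strict_mono_on_def)
  then show ?thesis
    using tendsto_nabla_moment[of 2 "\<lambda>i. if i = 1 then t else s" "\<lambda>_. 1"] assms
    by (simp add: numeral_2_eq_2)
qed

lemma
  assumes lam: "lam > 0" and b: "0 < b" and t: "0 < t" "t < s" "s \<le> T"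
  shows tendsto_nabla_cov: "((\<lambda>d. cov M (nabla X d t) (nabla X d s) / d\<^sup>2)
      \<longlongrightarrow> b * exp (- lam * T) * (exp (- lam * (s - t)) - b * exp (- lam * T))) (at_right 0)" (is ?cov)
    and tendsto_nabla_corr: "b \<le> 1 \<Longrightarrow> ((\<lambda>d. corr M (nabla X d t) (nabla X d s))
      \<longlongrightarrow> (exp (- lam * (s - t)) - b * exp (- lam * T)) / (1 - b * exp (- lam * T))) (at_right 0)"
proof -
  define a where "a = b * exp (- lam * T)"
  have small: "eventually (\<lambda>d. 0 < d \<and> d < t) (at_right 0)"
    using t eventually_at_right_field by (intro eventually_conj eventually_at_right_less) blast
  have "((\<lambda>d. expectation (\<lambda>\<omega>. nabla X d t \<omega> * nabla X d s \<omega>) / d\<^sup>2 - a\<^sup>2)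
      \<longlongrightarrow> a * exp (- lam * (s - t)) - a\<^sup>2) (at_right 0)"
    unfolding a_def by (intro tendsto_diff tendsto_const tendsto_nabla_mult assms)
  moreover have "eventually (\<lambda>d. expectation (\<lambda>\<omega>. nabla X d t \<omega> * nabla X d s \<omega>) / d\<^sup>2 - a\<^sup>2
      = cov M (nabla X d t) (nabla X d s) / d\<^sup>2) (at_right 0)"
    using small
  proof eventually_elim
    case (elim d)
    then show ?case
      using assms by (simp add: cov_nabla a_def diff_divide_distrib power_mult_distrib)
  qed
  ultimately have "((\<lambda>d. cov M (nabla X d t) (nabla X d s) / d\<^sup>2)
      \<longlongrightarrow> a * exp (- lam * (s - t)) - a\<^sup>2) (at_right 0)"
    by (rule Lim_transform_eventually)
  then show cov: ?cov
    by (simp add: a_def power2_eq_square algebra_simps)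
  \<comment> \<open>Stated for \<open>r \<ge> t\<close> so that the one condition
    \<open>d < t\<close> serves both \<open>r = t\<close> and \<open>r = s\<close>.\<close>
  have var: "((\<lambda>d. variance (nabla X d r) / d\<^sup>2) \<longlongrightarrow> a - a\<^sup>2) (at_right 0)" if r: "t \<le> r" "r \<le> T" for r
  proof -
    have "((\<lambda>d. expectation (\<lambda>\<omega>. (nabla X d r \<omega>)\<^sup>2) / d\<^sup>2 - a\<^sup>2) \<longlongrightarrow> a - a\<^sup>2) (at_right 0)"
      unfolding a_def using assms r by (intro tendsto_diff tendsto_const tendsto_nabla_moment_single) auto
    moreover have "eventually (\<lambda>d. expectation (\<lambda>\<omega>. (nabla X d r \<omega>)\<^sup>2) / d\<^sup>2 - a\<^sup>2
        = variance (nabla X d r) / d\<^sup>2) (at_right 0)"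
      using small
    proof eventually_elim
      case (elim d)
      then show ?case
        using assms r by (simp add: variance_nabla a_def diff_divide_distrib power_mult_distrib)
    qed
    ultimately show ?thesis by (rule Lim_transform_eventually)
  qed
  show "((\<lambda>d. corr M (nabla X d t) (nabla X d s))
      \<longlongrightarrow> (exp (- lam * (s - t)) - b * exp (- lam * T)) / (1 - b * exp (- lam * T))) (at_right 0)" if b1: "b \<le> 1"
  proof -
    have "a \<le> exp (- lam * T)" using b1 by (simp add: a_def)
    also have "\<dots> < 1" using assms by simp
    finally have a: "a < 1" "0 < a" using b by (auto simp: a_def)
    then have pos: "0 < a - a\<^sup>2" by (simp add: power2_eq_square)
    \<comment> \<open>Covariance and both variances are normalised by \<open>d\<^sup>2\<close>,
      which cancels in the correlation; \<open>0 < a - a\<^sup>2\<close> keeps the limit of the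
      denominator away from 0.\<close>
    have ratio: "((\<lambda>d. (cov M (nabla X d t) (nabla X d s) / d\<^sup>2) /
          (sqrt (variance (nabla X d t) / d\<^sup>2) * sqrt (variance (nabla X d s) / d\<^sup>2)))
        \<longlongrightarrow> a * (exp (- lam * (s - t)) - a) / (sqrt (a - a\<^sup>2) * sqrt (a - a\<^sup>2))) (at_right 0)"
      using cov[folded a_def] pos t by (intro tendsto_divide tendsto_mult tendsto_real_sqrt var) auto
    have limit: "a * (exp (- lam * (s - t)) - a) / (sqrt (a - a\<^sup>2) * sqrt (a - a\<^sup>2))
        = (exp (- lam * (s - t)) - a) / (1 - a)"
    proof -
      have "sqrt (a - a\<^sup>2) * sqrt (a - a\<^sup>2) = a * (1 - a)"
        using pos by (simp add: power2_eq_square algebra_simps)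
      then show ?thesis using a by simp
    qed
    have cancel: "eventually (\<lambda>d. (cov M (nabla X d t) (nabla X d s) / d\<^sup>2) /
          (sqrt (variance (nabla X d t) / d\<^sup>2) * sqrt (variance (nabla X d s) / d\<^sup>2))
        = corr M (nabla X d t) (nabla X d s)) (at_right 0)"
      using small
    proof eventually_elim
      case (elim d)
      then show ?case
        by (simp add: corr_def real_sqrt_divide power2_eq_square)
    qed
    show ?thesis
      unfolding a_def[symmetric] by (rule Lim_transform_eventually[OF ratio[unfolded limit] cancel])
  qed
qed

end

section \<open>Asymptotic equivalences\<close>

lemma asymp_equiv_mult_limit:
  fixes f g :: "'a \<Rightarrow> real"
  assumes "((\<lambda>x. f x / g x) \<longlongrightarrow> c) F" "c \<noteq> 0"
  shows "f \<sim>[F] (\<lambda>x. g x * c)"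
proof (rule asymp_equivI')
  have "((\<lambda>x. f x / g x / c) \<longlongrightarrow> c / c) F"
    using assms by (intro tendsto_divide tendsto_const)
  then show "((\<lambda>x. f x / (g x * c)) \<longlongrightarrow> 1) F"
    using assms by simp
qed

lemma filterlim_gap_to_0: "((\<lambda>(t, s). s - t) \<longlongrightarrow> 0) (gap_to_0 d T)"
  unfolding gap_to_0_def by (rule filterlim_mono[OF filterlim_filtercomap order.refl inf_le1])

lemma eventually_gap_to_0: "eventually (\<lambda>(t, s). d \<le> t \<and> 0 < s - t \<and> s - t < d \<and> s \<le> T) (gap_to_0 d T)"
  unfolding gap_to_0_def eventually_inf_principal by (auto intro!: always_eventually)

text \<open>The bound in \<open>corr_nabla_overlapping\<close> depends on the pair only through
  \<open>s - t\<close>, so it passes to the limit over pairs; likewise the variance on the right is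
  the constant \<open>v\<close>. For \<open>d \<ge> T\<close> no pair is admissible and the filter
  is trivial.\<close>

lemma (in exp_process) corr_nabla_gap_asymp_equiv:
  assumes lam: "lam > 0" and b: "0 < b" "b \<le> 1" and d: "d > 0"
  shows "(\<lambda>(t, s). corr M (nabla X d t) (nabla X d s)) \<sim>[gap_to_0 d T]
    (\<lambda>(t, s). 1 - 2 * b * exp (- lam * T) / (lam\<^sup>2 * variance (nabla X d t)) * (s - t))"
proof (rule asymp_equivI')
  define v where "v = variance (nabla X d d)"
  note gap = filterlim_gap_to_0[of d T, unfolded case_prod_beta]
  have "((\<lambda>z. 2 * b * exp (- lam * T) * exp (lam * d) / v * (snd z - fst z)\<^sup>2)
      \<longlongrightarrow> 2 * b * exp (- lam * T) * exp (lam * d) / v * 0\<^sup>2) (gap_to_0 d T)"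
    by (intro tendsto_mult tendsto_const tendsto_power gap)
  then have bound: "((\<lambda>z. 2 * b * exp (- lam * T) * exp (lam * d) / v * (snd z - fst z)\<^sup>2) \<longlongrightarrow> 0) (gap_to_0 d T)"
    by simp
  have "((\<lambda>z. corr M (nabla X d (fst z)) (nabla X d (snd z)) - 1) \<longlongrightarrow> 0) (gap_to_0 d T)"
  proof (rule Lim_null_comparison[OF _ bound])
    show "eventually (\<lambda>z. norm (corr M (nabla X d (fst z)) (nabla X d (snd z)) - 1)
        \<le> 2 * b * exp (- lam * T) * exp (lam * d) / v * (snd z - fst z)\<^sup>2) (gap_to_0 d T)"
      using eventually_gap_to_0
    proof eventually_elim
      case (elim z)
      then show ?case
        using corr_nabla_overlapping[OF lam b d, of "fst z" "snd z"] by (auto simp: v_def case_prod_beta)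
    qed
  qed
  from tendsto_add[OF this tendsto_const[of 1]]
  have corr: "((\<lambda>z. corr M (nabla X d (fst z)) (nabla X d (snd z))) \<longlongrightarrow> 1) (gap_to_0 d T)"
    by simp
  have "((\<lambda>z. 1 - 2 * b * exp (- lam * T) / (lam\<^sup>2 * v) * (snd z - fst z))
      \<longlongrightarrow> 1 - 2 * b * exp (- lam * T) / (lam\<^sup>2 * v) * 0) (gap_to_0 d T)"
    by (intro tendsto_diff tendsto_mult tendsto_const gap)
  then have lin: "((\<lambda>z. 1 - 2 * b * exp (- lam * T) / (lam\<^sup>2 * v) * (snd z - fst z)) \<longlongrightarrow> 1) (gap_to_0 d T)"
    by simp
  have "((\<lambda>z. 1 - 2 * b * exp (- lam * T) / (lam\<^sup>2 * variance (nabla X d (fst z))) * (snd z - fst z)) \<longlongrightarrow> 1)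
      (gap_to_0 d T)"
  proof (rule Lim_transform_eventually[OF lin])
    show "eventually (\<lambda>z. 1 - 2 * b * exp (- lam * T) / (lam\<^sup>2 * v) * (snd z - fst z)
        = 1 - 2 * b * exp (- lam * T) / (lam\<^sup>2 * variance (nabla X d (fst z))) * (snd z - fst z)) (gap_to_0 d T)"
      using eventually_gap_to_0
    proof eventually_elim
      case (elim z)
      then have "variance (nabla X d (fst z)) = v"
        unfolding v_def using lam b d by (intro variance_nabla_stationary) (auto simp: case_prod_beta)
      then show ?case by simp
    qed
  qed
  from tendsto_divide[OF corr this] show "((\<lambda>z. (case z of (t, s) \<Rightarrow> corr M (nabla X d t) (nabla X d s)) /
      (case z of (t, s) \<Rightarrow> 1 - 2 * b * exp (- lam * T) / (lam\<^sup>2 * variance (nabla X d t)) * (s - t)))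
      \<longlongrightarrow> 1) (gap_to_0 d T)"
    by (simp add: case_prod_beta)
qed

text \<open>Since \<open>d < s - t\<close>, the two increments are over separated intervals, and
  their product moment is known exactly; what remains is to pull out
  \<open>exp (- lam * (s - t))\<close>.\<close>

lemma (in exp_process) expectation_nabla_mult:
  assumes lam: "lam > 0" and t: "s < T" and d: "0 < d" "d < s - t" "d \<le> t"
  shows "expectation (\<lambda>\<omega>. nabla X d t \<omega> * nabla X d s \<omega>) =
             b * exp (- lam * T) / lam\<^sup>2 * exp (- lam * (s - t)) * (exp (lam * d) - 2 + exp (- lam * d))"
proof -
  have "(exp (lam * t) - exp (lam * (t - d))) * (exp (- lam * (s - d)) - exp (- lam * s))
      = (exp (lam * t) * exp (- lam * s)) * ((1 - exp (- lam * d)) * (exp (lam * d) - 1))"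
    by (simp add: algebra_simps exp_add[symmetric] exp_diff[symmetric])
  also have "exp (lam * t) * exp (- lam * s) = exp (- lam * (s - t))"
    by (simp add: exp_add[symmetric] algebra_simps)
  also have "(1 - exp (- lam * d)) * (exp (lam * d) - 1) = exp (lam * d) - 2 + exp (- lam * d)"
    by (simp add: algebra_simps exp_add[symmetric])
  finally show ?thesis
    using expectation_increment_mult[OF lam, of "t - d" t "s - d" s] assms
    by (simp add: nabla_def)
qed

theorem proposition3p8:
  fixes M :: "'a measure" and X :: "real \<Rightarrow> 'a \<Rightarrow> real" and lam b T :: real
  assumes "lam > 0" and "0 < b" and "b \<le> 1" and "T > 0"
    and "exp_process M lam b T X"
  shows
    "(\<forall>t s. 0 < t \<and> t < s \<and> s < T \<longrightarrow>
        (\<forall>d. 0 < d \<and> d < s - t \<and> d \<le> t \<longrightarrow>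
           prob_space.expectation M (\<lambda>\<omega>. nabla X d t \<omega> * nabla X d s \<omega>) =
             b * exp (- lam * T) / lam\<^sup>2 * exp (- lam * (s - t)) *
               (exp (lam * d) - 2 + exp (- lam * d))) \<and>
        (\<lambda>d. prob_space.expectation M (\<lambda>\<omega>. nabla X d t \<omega> * nabla X d s \<omega>)) \<sim>[at_right 0]
          (\<lambda>d. d\<^sup>2 * (b * exp (- lam * T)) * exp (- lam * (s - t))) \<and>
        (\<lambda>d. cov M (nabla X d t) (nabla X d s)) \<sim>[at_right 0]
          (\<lambda>d. d\<^sup>2 * (b * exp (- lam * T)) * (exp (- lam * (s - t)) - b * exp (- lam * T))) \<and>
        (\<lambda>d. corr M (nabla X d t) (nabla X d s)) \<sim>[at_right 0]
          (\<lambda>d. (exp (- lam * (s - t)) - b * exp (- lam * T)) / (1 - b * exp (- lam * T)))) \<and>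
     (\<forall>d>0.
        (\<lambda>(t, s). corr M (nabla X d t) (nabla X d s)) \<sim>[gap_to_0 d T]
          (\<lambda>(t, s). 1 - 2 * b * exp (- lam * T) / (lam\<^sup>2 * prob_space.variance M (nabla X d t)) * (s - t))) \<and>
     (\<forall>(m::nat) (t::nat \<Rightarrow> real) (k::nat \<Rightarrow> nat).
        1 \<le> m \<and> 0 < t 1 \<and> strict_mono_on {1..m} t \<and> t m \<le> T \<and> (\<forall>i\<in>{1..m}. 1 \<le> k i) \<longrightarrow>
        (\<lambda>d. prob_space.expectation M (\<lambda>\<omega>. \<Prod>i=1..m. nabla X d (t i) \<omega> ^ k i)) \<sim>[at_right 0]
          (\<lambda>d. d ^ (\<Sum>i=1..m. k i) * (b * exp (- lam * T)) * exp (- lam * (t m - t 1))) \<and>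
        ((\<lambda>d. prob_space.expectation M (\<lambda>\<omega>. \<Prod>i=1..m. nabla X d (t i) \<omega> ^ k i) /
               (\<Prod>i=1..m. prob_space.expectation M (\<lambda>\<omega>. nabla X d (t i) \<omega> ^ k i)))
          \<longlongrightarrow> (1 / (b * exp (- lam * T))) ^ (m - 1) * exp (- lam * (t m - t 1))) (at_right 0))"
proof -
  interpret exp_process M lam b T X by fact
  define a where "a = b * exp (- lam * T)"
  have a: "a > 0" using assms(2) by (simp add: a_def)
  have part1: "expectation (\<lambda>\<omega>. nabla X d t \<omega> * nabla X d s \<omega>) =
             b * exp (- lam * T) / lam\<^sup>2 * exp (- lam * (s - t)) * (exp (lam * d) - 2 + exp (- lam * d))"
    if "0 < t \<and> t < s \<and> s < T" "0 < d \<and> d < s - t \<and> d \<le> t" for t s d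
    using that assms by (intro expectation_nabla_mult) auto
  have part2: "(\<lambda>d. expectation (\<lambda>\<omega>. nabla X d t \<omega> * nabla X d s \<omega>)) \<sim>[at_right 0]
          (\<lambda>d. d\<^sup>2 * (b * exp (- lam * T)) * exp (- lam * (s - t)))"
    and part3: "(\<lambda>d. cov M (nabla X d t) (nabla X d s)) \<sim>[at_right 0]
          (\<lambda>d. d\<^sup>2 * (b * exp (- lam * T)) * (exp (- lam * (s - t)) - b * exp (- lam * T)))"
    and part4: "(\<lambda>d. corr M (nabla X d t) (nabla X d s)) \<sim>[at_right 0]
          (\<lambda>d. (exp (- lam * (s - t)) - b * exp (- lam * T)) / (1 - b * exp (- lam * T)))"
    if ts: "0 < t \<and> t < s \<and> s < T" for t s
  proof -
    \<comment> \<open>As \<open>s - t < T\<close>, this yields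
      \<open>a < exp (- lam * (s - t)) < 1\<close>. The limits of the normalised covariance and of
      the correlation are thus nonzero, as asymptotic equivalence requires.\<close>
    have "a \<le> exp (- lam * T)" using assms by (simp add: a_def)
    also have "\<dots> < exp (- lam * (s - t))" using assms ts by simp
    finally have lt: "a < exp (- lam * (s - t))" .
    also have "\<dots> < 1" using assms ts by simp
    finally have a1: "a < 1" .
    show "(\<lambda>d. expectation (\<lambda>\<omega>. nabla X d t \<omega> * nabla X d s \<omega>)) \<sim>[at_right 0]
          (\<lambda>d. d\<^sup>2 * (b * exp (- lam * T)) * exp (- lam * (s - t)))"
      using asymp_equiv_mult_limit[OF tendsto_nabla_mult[of t s]] assms ts by (simp add: mult.assoc)
    show "(\<lambda>d. cov M (nabla X d t) (nabla X d s)) \<sim>[at_right 0]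
          (\<lambda>d. d\<^sup>2 * (b * exp (- lam * T)) * (exp (- lam * (s - t)) - b * exp (- lam * T)))"
      using asymp_equiv_mult_limit[OF tendsto_nabla_cov[of t s]] assms ts lt by (simp add: mult.assoc a_def)
    show "(\<lambda>d. corr M (nabla X d t) (nabla X d s)) \<sim>[at_right 0]
          (\<lambda>d. (exp (- lam * (s - t)) - b * exp (- lam * T)) / (1 - b * exp (- lam * T)))"
      using asymp_equiv_mult_limit[where g = "\<lambda>_. 1", simplified, OF tendsto_nabla_corr[of t s]] assms ts lt a1
      by (simp add: a_def)
  qed
  have part5: "(\<lambda>d. expectation (\<lambda>\<omega>. \<Prod>i=1..m. nabla X d (t i) \<omega> ^ k i)) \<sim>[at_right 0]
          (\<lambda>d. d ^ (\<Sum>i=1..m. k i) * (b * exp (- lam * T)) * exp (- lam * (t m - t 1)))"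
    and part6: "((\<lambda>d. expectation (\<lambda>\<omega>. \<Prod>i=1..m. nabla X d (t i) \<omega> ^ k i) /
               (\<Prod>i=1..m. expectation (\<lambda>\<omega>. nabla X d (t i) \<omega> ^ k i)))
          \<longlongrightarrow> (1 / (b * exp (- lam * T))) ^ (m - 1) * exp (- lam * (t m - t 1))) (at_right 0)"
    if "1 \<le> m \<and> 0 < t 1 \<and> strict_mono_on {1..m} t \<and> t m \<le> T \<and> (\<forall>i\<in>{1..m}. 1 \<le> k i)"
    for m t and k :: "nat \<Rightarrow> nat"
  proof -
    have m: "1 \<le> m" and t: "0 < t 1" "strict_mono_on {1..m} t" "t m \<le> T" and k: "\<forall>i\<in>{1..m}. 1 \<le> k i"
      using that by auto
    note lim = tendsto_nabla_moment[OF assms(1,2) m t k, folded a_def]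
    show "(\<lambda>d. expectation (\<lambda>\<omega>. \<Prod>i=1..m. nabla X d (t i) \<omega> ^ k i)) \<sim>[at_right 0]
          (\<lambda>d. d ^ (\<Sum>i=1..m. k i) * (b * exp (- lam * T)) * exp (- lam * (t m - t 1)))"
      using asymp_equiv_mult_limit[OF lim] a unfolding a_def[symmetric] by (simp add: mult.assoc)
    have single: "((\<lambda>d. expectation (\<lambda>\<omega>. nabla X d (t i) \<omega> ^ k i) / d ^ k i) \<longlongrightarrow> a) (at_right 0)"
      if i: "i \<in> {1..m}" for i
    proof -
      have "t 1 \<le> t i" "t i \<le> t m"
        using i by (auto intro!: strict_mono_on_leD[OF t(2)])
      then show ?thesis
        unfolding a_def using assms t k i by (intro tendsto_nabla_moment_single) auto
    qed
    have ratio: "((\<lambda>d. (expectation (\<lambda>\<omega>. \<Prod>i=1..m. nabla X d (t i) \<omega> ^ k i) / d ^ (\<Sum>i=1..m. k i)) /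
        (\<Prod>i=1..m. expectation (\<lambda>\<omega>. nabla X d (t i) \<omega> ^ k i) / d ^ k i))
        \<longlongrightarrow> a * exp (- lam * (t m - t 1)) / (\<Prod>i=1..m. a)) (at_right 0)"
      using a by (intro tendsto_divide lim tendsto_prod single) auto
    \<comment> \<open>One factor \<open>a\<close> of the \<open>m\<close> in the denominator
      cancels; \<open>m \<ge> 1\<close> ensures that the subtraction in \<open>m - 1\<close> is not
      truncated.\<close>
    have limit: "a * exp (- lam * (t m - t 1)) / (\<Prod>i=1..m. a) = (1 / a) ^ (m - 1) * exp (- lam * (t m - t 1))"
      using a m by (cases m) (auto simp: power_divide)
    have cancel: "eventually (\<lambda>d. (expectation (\<lambda>\<omega>. \<Prod>i=1..m. nabla X d (t i) \<omega> ^ k i) / d ^ (\<Sum>i=1..m. k i)) /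
        (\<Prod>i=1..m. expectation (\<lambda>\<omega>. nabla X d (t i) \<omega> ^ k i) / d ^ k i)
        = expectation (\<lambda>\<omega>. \<Prod>i=1..m. nabla X d (t i) \<omega> ^ k i) /
          (\<Prod>i=1..m. expectation (\<lambda>\<omega>. nabla X d (t i) \<omega> ^ k i))) (at_right 0)"
      using eventually_at_right_less[of "0 :: real"]
    proof eventually_elim
      case (elim d)
      then show ?case by (simp add: prod_dividef power_sum)
    qed
    show "((\<lambda>d. expectation (\<lambda>\<omega>. \<Prod>i=1..m. nabla X d (t i) \<omega> ^ k i) /
               (\<Prod>i=1..m. expectation (\<lambda>\<omega>. nabla X d (t i) \<omega> ^ k i)))
          \<longlongrightarrow> (1 / (b * exp (- lam * T))) ^ (m - 1) * exp (- lam * (t m - t 1))) (at_right 0)"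
      unfolding a_def[symmetric] by (rule Lim_transform_eventually[OF ratio[unfolded limit] cancel])
  qed
  show ?thesis
    by (intro conjI allI impI;
        (rule part1 part2 part3 part4 part5 part6 corr_nabla_gap_asymp_equiv[OF assms(1-3)]; assumption))
qed

end
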